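(* Let $G$ be a connected Feynman graph and let $\gamma\subset E_G$ be an edge-subgraph with any number of connected components. Then $$\Xi_G(q,m)=\Psi_\gamma\,\Xi_{G/\gamma}(q,m)+R^{\Xi,\mathrm{UV}}_{\gamma,G}(q,m),$$ where $R^{\Xi,\mathrm{UV}}_{\gamma,G}(q,m)$ has degree $>h_\gamma$ in the variables $\alpha_e$, $e\in E_\gamma$. If moreover $\gamma$ is mass-momentum spanning in $G$, then $$\Xi_G(q,m)=\Xi_\gamma(q,m)\,\Psi_{G/\gamma}+R^{\Xi,\mathrm{IR}}_{\gamma,G}(q,m),$$ where $R^{\Xi,\mathrm{IR}}_{\gamma,G}(q,m)$ has degree $>h_\gamma+1$ in the variables $\alpha_e$, $e\in E_\gamma$. (Degree $>r$ means that every monomial occurring has total degree $>r$ in these variables.)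
   Context: A Feynman graph $G=(V_G,E_G,E_G^{\mathrm{ext}})$ is a finite graph with vertices $V_G$, internal edges $E_G$ (multiple edges and self-edges allowed) and external half-edges $E_G^{\mathrm{ext}}$, each attached to a vertex, such that all vertices carrying external half-edges lie in one connected component. Each internal edge $e$ has a mass $m_e\in\mathbb R$ (massive if $m_e\neq0$), each external half-edge $i$ carries an incoming momentum $q_i\in\mathbb R^d$, and $\sum_iq_i=0$. $h_G$ denotes the loop number (first Betti number). A subset $\gamma\subset E_G$ is identified with the edge-subgraph with edge set $E_\gamma=\gamma$ and vertex set the set of endpoints of edges in $\gamma$. It is momentum-spanning if all vertices of $G$ carrying external half-edges are vertices of $\gamma$ and lie in a single connected component of $\gamma$; mass-spanning if it contains all massive edges of $G$; mass-momentum spanning if both. A mass-momentum spanning $\gamma$ inherits all masses and external half-edges of $G$. The quotient $G/\gamma$ is obtained by removing the edges of $\gamma$ and identifying all vertices in each connected component of $\gamma$; it inherits the external half-edges of $G$ and the masses of the remaining edges. To each internal edge $e$ is associated a variable $\alpha_e$. A spanning $k$-tree is a subgraph containing all vertices, with no loops and exactly $k$ connected components. For $G$ connected, $$\Psi_G=\sum_{T}\prod_{e\notin T}\alpha_e,\qquad \Phi_G(q)=\sum_{T_1\cup T_2}(q^{T_1})^2\prod_{e\notin T_1\cup T_2}\alpha_e,$$ the sums being over spanning trees $T$ and spanning $2$-trees $T_1\cup T_2$, with $q^{T_1}$ the sum of the momenta entering $T_1$. If $G$ has connected components $G_0$ (containing all external momenta)$,G_1,\dots,G_n$, then $\Psi_G=\prod_{i\ge0}\Psi_{G_i}$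 and $\Phi_G(q)=\Phi_{G_0}(q)\prod_{i\ge1}\Psi_{G_i}$. Finally $\Xi_G(q,m)=\Phi_G(q)+\big(\sum_{e\in E_G}m_e^2\alpha_e\big)\Psi_G$. *)

theory Defs
  imports "HOL-Analysis.Analysis" "HOL-Library.Poly_Mapping"
    "HOL-Library.Function_Algebras"
begin

text \<open>
  The orientation of an edge from \<open>tail\<close> to \<open>head\<close> is an arbitrary choice. It is used to write down
  the boundary map of simplicial chains; connectivity, and hence everything else, ignores it.
\<close>

record ('v, 'e, 'x, 'd :: finite) fgraph =
  verts :: "'v set"
  edges :: "'e set"
  tail :: "'e \<Rightarrow> 'v"
  head :: "'e \<Rightarrow> 'v"
  legs :: "'x set"
  leg_at :: "'x \<Rightarrow> 'v"
  mass :: "'e \<Rightarrow> real"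
  momentum :: "'x \<Rightarrow> real ^ 'd"

definition adj :: "('v, 'e, 'x, 'd :: finite) fgraph \<Rightarrow> 'v rel" where
  "adj G = {(u, v). \<exists>e\<in>edges G. (tail G e = u \<and> head G e = v) \<or> (tail G e = v \<and> head G e = u)}"

definition components :: "('v, 'e, 'x, 'd :: finite) fgraph \<Rightarrow> 'v set set" where
  "components G = verts G // {(u, v). u \<in> verts G \<and> v \<in> verts G \<and> (u, v) \<in> (adj G)\<^sup>*}"

definition connected_graph :: "('v, 'e, 'x, 'd :: finite) fgraph \<Rightarrow> bool" where
  "connected_graph G \<longleftrightarrow> card (components G) = 1"

definition feynman_graph :: "('v, 'e, 'x, 'd :: finite) fgraph \<Rightarrow> bool" where
  "feynman_graph G \<longleftrightarrow>
     finite (verts G) \<and> finite (edges G) \<and> finite (legs G) \<and>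
     (\<forall>e\<in>edges G. tail G e \<in> verts G \<and> head G e \<in> verts G) \<and>
     (\<forall>i\<in>legs G. leg_at G i \<in> verts G) \<and>
     (\<forall>i\<in>legs G. \<forall>j\<in>legs G. \<exists>C\<in>components G. leg_at G i \<in> C \<and> leg_at G j \<in> C) \<and>
     (\<Sum>i\<in>legs G. momentum G i) = 0"

text \<open>
  The loop number is the first Betti number: a graph has no 2-cells, so the first homology with
  real coefficients is the kernel of the boundary map on 1-chains.
\<close>

definition boundary :: "('v, 'e, 'x, 'd :: finite) fgraph \<Rightarrow> ('e \<Rightarrow> real) \<Rightarrow> 'v \<Rightarrow> real" where
  "boundary G c v = (\<Sum>e\<in>edges G. c e * (of_bool (head G e = v) - of_bool (tail G e = v)))"

definition cycle_space :: "('v, 'e, 'x, 'd :: finite) fgraph \<Rightarrow> ('e \<Rightarrow> real) set" where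
  "cycle_space G = {c. (\<forall>e. e \<notin> edges G \<longrightarrow> c e = 0) \<and> (\<forall>v\<in>verts G. boundary G c v = 0)}"

definition loop_number :: "('v, 'e, 'x, 'd :: finite) fgraph \<Rightarrow> nat" where
  "loop_number G = vector_space.dim (\<lambda>(r :: real) c e. r * c e) (cycle_space G)"

definition spanning_trees :: "nat \<Rightarrow> ('v, 'e, 'x, 'd :: finite) fgraph \<Rightarrow> 'e set set" where
  "spanning_trees k G = {T. T \<subseteq> edges G \<and> loop_number (G\<lparr>edges := T\<rparr>) = 0 \<and>
                            card (components (G\<lparr>edges := T\<rparr>)) = k}"

text \<open>
  Real polynomials in variables indexed by edges: a monomial is a finitely supported exponent
  function, a polynomial a finitely supported coefficient function on monomials.
\<close>

type_synonym 'e edge_poly = "('e \<Rightarrow>\<^sub>0 nat) \<Rightarrow>\<^sub>0 real"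

definition \<alpha> :: "'e \<Rightarrow> 'e edge_poly" where
  "\<alpha> e = Poly_Mapping.single (Poly_Mapping.single e 1) 1"

definition const :: "real \<Rightarrow> 'e edge_poly" where
  "const r = Poly_Mapping.single 0 r"

definition degree_greater :: "'e set \<Rightarrow> nat \<Rightarrow> 'e edge_poly \<Rightarrow> bool" where
  "degree_greater S r p \<longleftrightarrow>
     (\<forall>\<mu>\<in>Poly_Mapping.keys p. r < (\<Sum>e\<in>S. Poly_Mapping.lookup \<mu> e))"

definition momentum_into :: "('v, 'e, 'x, 'd :: finite) fgraph \<Rightarrow> 'v set \<Rightarrow> real ^ 'd" where
  "momentum_into G C = (\<Sum>i\<in>{i\<in>legs G. leg_at G i \<in> C}. momentum G i)"

text \<open>
  For a spanning 2-tree \<open>F\<close> the momenta entering its two trees are opposite, so the square does not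
  depend on which of them is chosen.
\<close>

definition tree_momentum_sq :: "('v, 'e, 'x, 'd :: finite) fgraph \<Rightarrow> 'e set \<Rightarrow> real" where
  "tree_momentum_sq G F =
     (let q = momentum_into G (SOME C. C \<in> components (G\<lparr>edges := F\<rparr>)) in q \<bullet> q)"

definition \<Psi>_conn :: "('v, 'e, 'x, 'd :: finite) fgraph \<Rightarrow> 'e edge_poly" where
  "\<Psi>_conn G = (\<Sum>T\<in>spanning_trees 1 G. \<Prod>e\<in>edges G - T. \<alpha> e)"

definition \<Phi>_conn :: "('v, 'e, 'x, 'd :: finite) fgraph \<Rightarrow> 'e edge_poly" where
  "\<Phi>_conn G =
     (\<Sum>F\<in>spanning_trees 2 G. const (tree_momentum_sq G F) * (\<Prod>e\<in>edges G - F. \<alpha> e))"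

definition induced :: "('v, 'e, 'x, 'd :: finite) fgraph \<Rightarrow> 'v set \<Rightarrow> ('v, 'e, 'x, 'd) fgraph" where
  "induced G C = G\<lparr>verts := C, edges := {e\<in>edges G. tail G e \<in> C \<and> head G e \<in> C},
                   legs := {i\<in>legs G. leg_at G i \<in> C}\<rparr>"

definition \<Psi> :: "('v, 'e, 'x, 'd :: finite) fgraph \<Rightarrow> 'e edge_poly" where
  "\<Psi> G = (\<Prod>C\<in>components G. \<Psi>_conn (induced G C))"

text \<open>
  Without external half-edges the distinguished component is not determined, and a graph without
  vertices has none; as \<open>\<Phi>_conn\<close> then vanishes on every component, \<open>\<Phi>\<close> is \<open>0\<close> for any choice.
\<close>

definition \<Phi> :: "('v, 'e, 'x, 'd :: finite) fgraph \<Rightarrow> 'e edge_poly" where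
  "\<Phi> G = (if legs G = {} then 0 else
     (let C\<^sub>0 = (THE C. C \<in> components G \<and> leg_at G ` legs G \<subseteq> C)
      in \<Phi>_conn (induced G C\<^sub>0) * (\<Prod>C\<in>components G - {C\<^sub>0}. \<Psi>_conn (induced G C))))"

definition \<Xi> :: "('v, 'e, 'x, 'd :: finite) fgraph \<Rightarrow> 'e edge_poly" where
  "\<Xi> G = \<Phi> G + (\<Sum>e\<in>edges G. const ((mass G e)\<^sup>2) * \<alpha> e) * \<Psi> G"

definition bare_subgraph :: "('v, 'e, 'x, 'd :: finite) fgraph \<Rightarrow> 'e set \<Rightarrow> ('v, 'e, 'x, 'd) fgraph" where
  "bare_subgraph G \<gamma> = G\<lparr>verts := tail G ` \<gamma> \<union> head G ` \<gamma>, edges := \<gamma>,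
                          legs := {}, mass := (\<lambda>_. 0)\<rparr>"

definition momentum_spanning :: "('v, 'e, 'x, 'd :: finite) fgraph \<Rightarrow> 'e set \<Rightarrow> bool" where
  "momentum_spanning G \<gamma> \<longleftrightarrow>
     (\<forall>i\<in>legs G. leg_at G i \<in> verts (bare_subgraph G \<gamma>)) \<and>
     (\<forall>i\<in>legs G. \<forall>j\<in>legs G. \<exists>C\<in>components (bare_subgraph G \<gamma>). leg_at G i \<in> C \<and> leg_at G j \<in> C)"

definition mass_spanning :: "('v, 'e, 'x, 'd :: finite) fgraph \<Rightarrow> 'e set \<Rightarrow> bool" where
  "mass_spanning G \<gamma> \<longleftrightarrow> {e\<in>edges G. mass G e \<noteq> 0} \<subseteq> \<gamma>"

definition mass_momentum_spanning :: "('v, 'e, 'x, 'd :: finite) fgraph \<Rightarrow> 'e set \<Rightarrow> bool" where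
  "mass_momentum_spanning G \<gamma> \<longleftrightarrow> mass_spanning G \<gamma> \<and> momentum_spanning G \<gamma>"

text \<open>
  Kinematic data pass to a subgraph only if it is mass-momentum spanning; \<open>\<Psi>\<close> and \<open>loop_number\<close>
  do not see them.
\<close>

definition subgraph :: "('v, 'e, 'x, 'd :: finite) fgraph \<Rightarrow> 'e set \<Rightarrow> ('v, 'e, 'x, 'd) fgraph" where
  "subgraph G \<gamma> = (if mass_momentum_spanning G \<gamma>
     then (bare_subgraph G \<gamma>)\<lparr>legs := legs G, mass := mass G\<rparr>
     else bare_subgraph G \<gamma>)"

text \<open>
  A vertex of the quotient is the set of vertices of \<open>G\<close> identified to it: a component of \<open>\<gamma>\<close>, or a
  single vertex that is not an endpoint of an edge of \<open>\<gamma>\<close>.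
\<close>

definition contract :: "('v, 'e, 'x, 'd :: finite) fgraph \<Rightarrow> 'e set \<Rightarrow> 'v \<Rightarrow> 'v set" where
  "contract G \<gamma> v = {v} \<union> \<Union>{C\<in>components (subgraph G \<gamma>). v \<in> C}"

definition quotient_graph ::
    "('v, 'e, 'x, 'd :: finite) fgraph \<Rightarrow> 'e set \<Rightarrow> ('v set, 'e, 'x, 'd) fgraph" where
  "quotient_graph G \<gamma> =
     \<lparr>verts = contract G \<gamma> ` verts G, edges = edges G - \<gamma>,
      tail = (\<lambda>e. contract G \<gamma> (tail G e)), head = (\<lambda>e. contract G \<gamma> (head G e)),
      legs = legs G, leg_at = (\<lambda>i. contract G \<gamma> (leg_at G i)),
      mass = mass G, momentum = momentum G\<rparr>"

end

theory Submission
  imports Defs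
begin

text \<open>
  Write \<open>\<kappa>(S)\<close> for the number of components of the spanning subgraph of \<open>G\<close> with edge set \<open>S\<close>. By Euler's
  formula, \<open>S\<close> is a forest iff \<open>|S| + \<kappa>(S) = |V|\<close>, and in the quotient \<open>G/\<gamma>\<close> a set \<open>T\<close> has
  \<open>\<kappa>(\<gamma> \<union> T)\<close> components. Thus, for a forest \<open>F\<close> of \<open>G\<close>, the monomial of the complement of \<open>F\<close> has degree
  \<open>h + \<kappa>(F \<inter> \<gamma>) - \<kappa>(\<gamma>)\<close> in the variables of \<open>\<gamma>\<close>, where \<open>h\<close> is the loop number of \<open>\<gamma>\<close>. The forests of
  minimal degree are those for which \<open>F \<inter> \<gamma>\<close> is a maximal forest of \<open>\<gamma>\<close>, and \<open>F \<mapsto> (F \<inter> \<gamma>, F - \<gamma>)\<close> matches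
  them with pairs of a maximal forest of \<open>\<gamma>\<close> and a spanning forest of \<open>G/\<gamma>\<close>. If \<open>\<gamma>\<close> is momentum-spanning,
  such an \<open>F\<close> joins all external half-edges, so its squared momentum vanishes and the leading 2-forests
  are those with \<open>\<kappa>(F \<inter> \<gamma>) = \<kappa>(\<gamma>) + 1\<close> and \<open>F \<union> \<gamma>\<close> connected.
\<close>

section \<open>Connectivity by edge subsets\<close>

lemma quotient_image: "V // R = (\<lambda>v. R `` {v}) ` V"
  by (auto simp: quotient_def)

text \<open>Sending a class of the finer relation to the class of the coarser one that contains it
  is surjective. If the finite class numbers agree, it is injective as well, so no two classes
  merge. The second part turns an equality of component numbers into an equality of connectivity
  relations.\<close>

lemma card_quotient_mono:
  assumes "finite V" "equiv V R" "equiv V R'" "R \<subseteq> R'"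
  shows "card (V // R') \<le> card (V // R)"
    and "card (V // R') = card (V // R) \<Longrightarrow> R' = R"
proof -
  have cls: "R' `` (R `` {v}) = R' `` {v}" for v
    using refines_equiv_class_eq2[OF assms(4,2,3)] .
  have img: "(\<lambda>C. R' `` C) ` (V // R) = V // R'"
    using refines_equiv_image_eq[OF assms(4,2,3)] .
  have fin: "finite (V // R)"
    using finite_quotient[OF assms(1) equiv_type[OF assms(2)]] .
  show "card (V // R') \<le> card (V // R)"
    using finite_refines_card_le[OF fin assms(4,2,3)] .
  assume eq: "card (V // R') = card (V // R)"
  have inj: "inj_on (\<lambda>C. R' `` C) (V // R)"
    using eq_card_imp_inj_on[OF fin] eq img by metis
  show "R' = R"
  proof
    show "R' \<subseteq> R"
    proof clarify
      fix u v assume uv: "(u, v) \<in> R'"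
      then have V: "u \<in> V" "v \<in> V" using assms(3) by (auto simp: equiv_def refl_on_def)
      have "R' `` (R `` {u}) = R' `` (R `` {v})"
        using equiv_class_eq[OF assms(3) uv] by (simp add: cls)
      then have "R `` {u} = R `` {v}" using inj_onD[OF inj] V quotientI by metis
      then show "(u, v) \<in> R" using eq_equiv_class[OF _ assms(2)] V by blast
    qed
  qed (fact assms(4))
qed

text \<open>Taking images under \<open>f\<close> is a bijection between the two sets of classes,
  even if \<open>f\<close> itself is far from injective. It is meant for the map
  \<open>contract\<close>.\<close>

lemma card_quotient_surj:
  assumes "equiv V R" "equiv V' R'" "f ` V = V'"
    and "\<And>u v. u \<in> V \<Longrightarrow> v \<in> V \<Longrightarrow> (f u, f v) \<in> R' \<longleftrightarrow> (u, v) \<in> R"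
  shows "card (V' // R') = card (V // R)"
proof -
  have cls: "f ` (R `` {v}) = R' `` {f v}" if "v \<in> V" for v
  proof (intro equalityI subsetI)
    fix y assume "y \<in> f ` (R `` {v})"
    then obtain u where u: "y = f u" "(v, u) \<in> R" by auto
    then have "u \<in> V" using assms(1) by (auto simp: equiv_def refl_on_def)
    then show "y \<in> R' `` {f v}" using u assms(4)[OF that] by simp
  next
    fix y assume y: "y \<in> R' `` {f v}"
    then have "y \<in> V'" using assms(2) by (auto simp: equiv_def refl_on_def)
    then obtain u where "u \<in> V" "y = f u" using assms(3) by auto
    then show "y \<in> f ` (R `` {v})" using y assms(4)[OF that] by auto
  qed
  have img: "(\<lambda>C. f ` C) ` (V // R) = V' // R'"
    using assms(3) by (auto simp: quotient_image image_image cls cong: image_cong)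
  have "inj_on (\<lambda>C. f ` C) (V // R)"
  proof (rule inj_onI)
    fix C D assume CD: "C \<in> V // R" "D \<in> V // R" "f ` C = f ` D"
    then obtain u v where uv: "u \<in> V" "v \<in> V" "C = R `` {u}" "D = R `` {v}"
      by (auto simp: quotient_def)
    then have "R' `` {f u} = R' `` {f v}" using cls CD by metis
    then have "(f u, f v) \<in> R'"
      using eq_equiv_class[OF _ assms(2)] uv assms(3) by blast
    then show "C = D" using uv assms(1,4) by (simp add: equiv_class_eq)
  qed
  then show ?thesis using card_image img by metis
qed

section \<open>Connectivity of spanning subgraphs\<close>

definition well_formed :: "('v, 'e, 'x, 'd :: finite) fgraph \<Rightarrow> bool" where
  "well_formed G \<longleftrightarrow> finite (verts G) \<and> finite (edges G) \<and>
     (\<forall>e\<in>edges G. tail G e \<in> verts G \<and> head G e \<in> verts G)"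

text \<open>The relation lives on the whole vertex type, so it is literally the same for
  \<open>G\<close>, for an induced part and for an edge-subgraph. Its restriction
  \<open>joined_verts\<close> is the equivalence relation whose classes are the components.\<close>

definition joined :: "('v, 'e, 'x, 'd :: finite) fgraph \<Rightarrow> 'e set \<Rightarrow> 'v rel" where
  "joined G S = (adj (G\<lparr>edges := S\<rparr>))\<^sup>*"

definition joined_verts :: "('v, 'e, 'x, 'd :: finite) fgraph \<Rightarrow> 'e set \<Rightarrow> 'v rel" where
  "joined_verts G S = {(u, v). u \<in> verts G \<and> v \<in> verts G \<and> (u, v) \<in> joined G S}"

text \<open>This is \<kappa>(S): all vertices of \<open>G\<close> are kept, so each vertex without
  an edge in \<open>S\<close> counts as a component.\<close>

definition ncomp :: "('v, 'e, 'x, 'd :: finite) fgraph \<Rightarrow> 'e set \<Rightarrow> nat" where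
  "ncomp G S = card (components (G\<lparr>edges := S\<rparr>))"

lemma components_edges: "components (G\<lparr>edges := S\<rparr>) = verts G // joined_verts G S"
  by (simp add: components_def joined_verts_def joined_def)

lemma ncomp_quotient: "ncomp G S = card (verts G // joined_verts G S)"
  by (simp add: ncomp_def components_edges)

lemma ncomp_edges: "ncomp G (edges G) = card (components G)"
  by (simp add: ncomp_def)

lemma joined_refl [simp]: "(u, u) \<in> joined G S"
  by (simp add: joined_def)

lemma joined_sym: "(u, v) \<in> joined G S \<Longrightarrow> (v, u) \<in> joined G S"
proof -
  have "sym (adj (G\<lparr>edges := S\<rparr>))" by (auto simp: adj_def sym_def)
  then show "(u, v) \<in> joined G S \<Longrightarrow> (v, u) \<in> joined G S"
    unfolding joined_def by (meson sym_rtrancl symD)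
qed

lemma joined_trans: "(u, v) \<in> joined G S \<Longrightarrow> (v, w) \<in> joined G S \<Longrightarrow> (u, w) \<in> joined G S"
  unfolding joined_def by (rule rtrancl_trans)

lemma joined_edge: "e \<in> S \<Longrightarrow> (tail G e, head G e) \<in> joined G S"
  unfolding joined_def by (rule r_into_rtrancl) (auto simp: adj_def)

lemma joined_induct [consumes 1, case_names base edge]:
  assumes "(u, v) \<in> joined G S" "P u"
    and "\<And>x y e. (u, x) \<in> joined G S \<Longrightarrow> P x \<Longrightarrow> e \<in> S \<Longrightarrow>
      tail G e = x \<and> head G e = y \<or> tail G e = y \<and> head G e = x \<Longrightarrow> P y"
  shows "P v"
  using assms(1) unfolding joined_def
proof (induction rule: rtrancl_induct)
  case base
  show ?case by (fact assms(2))
next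
  case (step x y)
  then show ?case using assms(3)[of x _ y] by (auto simp: adj_def joined_def)
qed

lemma joined_subset:
  assumes "\<And>e. e \<in> S \<Longrightarrow> (tail G e, head G e) \<in> joined G S'"
  shows "joined G S \<subseteq> joined G S'"
proof clarify
  fix u v assume "(u, v) \<in> joined G S"
  then show "(u, v) \<in> joined G S'"
  proof (induction rule: joined_induct)
    case (edge x y e)
    have "(x, y) \<in> joined G S'"
      using edge(3) assms[OF edge(2)] joined_sym[OF assms[OF edge(2)]] by auto
    then show ?case using edge joined_trans by metis
  qed simp
qed

lemma joined_mono: "S \<subseteq> S' \<Longrightarrow> joined G S \<subseteq> joined G S'"
  by (rule joined_subset) (auto intro: joined_edge)

text \<open>A path can be shortened until it runs through the new edge at most once, in one of the
  two directions.\<close>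

lemma joined_insert:
  "(x, y) \<in> joined G (insert e S) \<longleftrightarrow> (x, y) \<in> joined G S \<or>
     (x, tail G e) \<in> joined G S \<and> (head G e, y) \<in> joined G S \<or>
     (x, head G e) \<in> joined G S \<and> (tail G e, y) \<in> joined G S"
  (is "_ \<longleftrightarrow> ?R x y")
proof
  assume "(x, y) \<in> joined G (insert e S)"
  then show "?R x y"
  proof (induction rule: joined_induct)
    case base
    then show ?case by simp
  next
    case (edge y z f)
    show ?case
    proof (cases "f \<in> S")
      case True
      then have "(y, z) \<in> joined G S" using edge joined_edge joined_sym by metis
      then show ?thesis using edge joined_trans by metis
    next
      case False
      then have "f = e" using edge by simp
      then show ?thesis using edge by (metis joined_refl joined_sym joined_trans)
    qed
  qed
next
  have e: "(tail G e, head G e) \<in> joined G (insert e S)" by (simp add: joined_edge)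
  have S: "joined G S \<subseteq> joined G (insert e S)" by (simp add: joined_mono subset_insertI)
  assume "?R x y"
  then show "(x, y) \<in> joined G (insert e S)"
  proof (elim disjE conjE)
    assume "(x, tail G e) \<in> joined G S" "(head G e, y) \<in> joined G S"
    then show ?thesis using S e by (blast intro: joined_trans)
  next
    assume "(x, head G e) \<in> joined G S" "(tail G e, y) \<in> joined G S"
    then show ?thesis using S joined_sym[OF e] by (blast intro: joined_trans)
  qed (use S in blast)
qed

lemma equiv_joined_verts: "equiv (verts G) (joined_verts G S)"
  by (rule equivI)
    (auto simp: joined_verts_def refl_on_def sym_def trans_def intro: joined_sym joined_trans)

lemma joined_verts_mono: "S \<subseteq> S' \<Longrightarrow> joined_verts G S \<subseteq> joined_verts G S'"
  using joined_mono unfolding joined_verts_def by blast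

lemma ncomp_antimono:
  assumes "finite (verts G)" "S \<subseteq> S'"
  shows "ncomp G S' \<le> ncomp G S"
    and "ncomp G S' = ncomp G S \<Longrightarrow> joined_verts G S' = joined_verts G S"
  unfolding ncomp_quotient
  using card_quotient_mono[OF assms(1) equiv_joined_verts equiv_joined_verts joined_verts_mono[OF assms(2)]]
  by blast+

lemma ncomp_empty:
  "ncomp G {} = card (verts G)"
proof -
  have "adj (G\<lparr>edges := {}\<rparr>) = {}" by (simp add: adj_def)
  then have "joined_verts G {} = Id_on (verts G)"
    by (auto simp: joined_verts_def joined_def)
  then have "verts G // joined_verts G {} = (\<lambda>v. {v}) ` verts G"
    by (auto simp: quotient_def Id_on_def)
  then show ?thesis by (simp add: ncomp_quotient card_image)
qed

lemma ncomp_insert_joined: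
  assumes "(tail G e, head G e) \<in> joined G S"
  shows "ncomp G (insert e S) = ncomp G S"
proof -
  have "joined G (insert e S) = joined G S"
    using assms by (intro equalityI joined_subset) (auto intro: joined_edge)
  then show ?thesis by (simp add: ncomp_quotient joined_verts_def)
qed

text \<open>The new edge merges the classes of its two endpoints and no others. That at least one
  class is lost follows from strict monotonicity, that at most one is lost from an injectivity
  argument.\<close>

lemma ncomp_insert_not_joined:
  assumes "finite (verts G)" "tail G e \<in> verts G" "head G e \<in> verts G"
    and "(tail G e, head G e) \<notin> joined G S"
  shows "Suc (ncomp G (insert e S)) = ncomp G S"
proof (rule antisym)
  let ?R = "joined_verts G S" and ?R' = "joined_verts G (insert e S)"
  have "?R' \<noteq> ?R"
    using assms joined_edge[of e "insert e S" G] by (auto simp: joined_verts_def)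
  then have "ncomp G (insert e S) \<noteq> ncomp G S" "ncomp G (insert e S) \<le> ncomp G S"
    using ncomp_antimono[OF assms(1) subset_insertI] by blast+
  then show "Suc (ncomp G (insert e S)) \<le> ncomp G S" by simp
  let ?C = "?R `` {tail G e}" and ?Q = "verts G // ?R"
  have fin: "finite ?Q"
    using finite_quotient[OF assms(1) equiv_type[OF equiv_joined_verts]] .
  have cls: "?R' `` (?R `` {v}) = ?R' `` {v}" for v
    by (rule refines_equiv_class_eq2[OF joined_verts_mono equiv_joined_verts equiv_joined_verts]) auto
  \<comment> \<open>Once the class of \<open>tail G e\<close> is set aside, nothing merges: by
    \<open>joined_insert\<close>, a pair joined only with the help of \<open>e\<close> has a member
    in that class.\<close>
  have "inj_on (\<lambda>C. ?R' `` C) (?Q - {?C})"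
  proof (rule inj_onI)
    fix C D assume CD: "C \<in> ?Q - {?C}" "D \<in> ?Q - {?C}" "?R' `` C = ?R' `` D"
    then obtain u v where uv: "u \<in> verts G" "v \<in> verts G" "C = ?R `` {u}" "D = ?R `` {v}"
      by (auto simp: quotient_def)
    have "?R' `` {u} = ?R' `` {v}" using CD(3) unfolding uv cls .
    then have "(u, v) \<in> ?R'"
      using eq_equiv_class[OF _ equiv_joined_verts uv(2)] by simp
    moreover have "(u, tail G e) \<notin> ?R"
      using equiv_class_eq[OF equiv_joined_verts, of u _ G S] CD(1) uv(3) by auto
    moreover have "(v, tail G e) \<notin> ?R"
      using equiv_class_eq[OF equiv_joined_verts, of v _ G S] CD(2) uv(4) by auto
    ultimately have "(u, v) \<in> ?R"
      using uv(1,2) assms(2,3) joined_sym[of _ _ G S]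
      unfolding joined_verts_def joined_insert by blast
    then show "C = D" using equiv_class_eq[OF equiv_joined_verts] uv by metis
  qed
  moreover have "(\<lambda>C. ?R' `` C) ` (?Q - {?C}) \<subseteq> verts G // ?R'"
    by (auto simp: quotient_image cls)
  moreover have "finite (verts G // ?R')"
    using finite_quotient[OF assms(1) equiv_type[OF equiv_joined_verts]] .
  ultimately have "card (?Q - {?C}) \<le> ncomp G (insert e S)"
    by (simp add: ncomp_quotient card_inj_on_le)
  moreover have "?C \<in> ?Q" using assms(2) by (simp add: quotientI)
  ultimately show "ncomp G S \<le> Suc (ncomp G (insert e S))"
    using fin by (simp add: ncomp_quotient card_Diff_singleton)
qed

section \<open>Euler's formula\<close>

text \<open>The scalar multiplication is the one in \<open>loop_number\<close>, so that its
  dimension is \<open>chains.dim\<close>.\<close>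

interpretation chains: vector_space "\<lambda>(r :: real) (c :: 'e \<Rightarrow> real) e. r * c e"
  by unfold_locales (auto simp: fun_eq_iff algebra_simps)

lemma boundary_support:
  assumes "finite S" "S' \<subseteq> S" "\<And>e. e \<notin> S' \<Longrightarrow> c e = 0"
  shows "boundary (G\<lparr>edges := S'\<rparr>) c v = boundary (G\<lparr>edges := S\<rparr>) c v"
  unfolding boundary_def using assms by (auto intro!: sum.mono_neutral_left)

lemma boundary_add:
  "boundary G (\<lambda>e. c e + r * d e) v = boundary G c v + r * boundary G d v"
  unfolding boundary_def sum_distrib_left sum.distrib[symmetric]
  by (rule sum.cong) (simp_all add: algebra_simps)

lemma boundary_indicator:
  assumes "finite (edges G)" "e \<in> edges G"
  shows "boundary G (\<lambda>f. of_bool (f = e)) v = of_bool (head G e = v) - of_bool (tail G e = v)"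
proof -
  have "boundary G (\<lambda>f. of_bool (f = e)) v =
      (\<Sum>f\<in>edges G. if f = e then of_bool (head G f = v) - of_bool (tail G f = v) else 0)"
    unfolding boundary_def by (rule sum.cong) auto
  then show ?thesis using assms by simp
qed

text \<open>The chain is a path from \<open>u\<close> to \<open>v\<close>, each edge counted with
  the sign of its traversal.\<close>

lemma joined_boundary:
  assumes "(u, v) \<in> joined G S" "finite S"
  obtains p where "\<And>e. e \<notin> S \<Longrightarrow> p e = 0"
    and "\<And>w. boundary (G\<lparr>edges := S\<rparr>) p w = of_bool (v = w) - of_bool (u = w)"
proof -
  have "\<exists>p. (\<forall>e. e \<notin> S \<longrightarrow> p e = 0) \<and>
      (\<forall>w. boundary (G\<lparr>edges := S\<rparr>) p w = of_bool (v = w) - of_bool (u = w))"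
    using assms(1)
  proof (induction rule: joined_induct)
    case base
    show ?case by (rule exI[of _ "\<lambda>_. 0"]) (simp add: boundary_def)
  next
    case (edge x y e)
    then obtain p where p: "\<And>e. e \<notin> S \<Longrightarrow> p e = 0"
      "\<And>w. boundary (G\<lparr>edges := S\<rparr>) p w = of_bool (x = w) - of_bool (u = w)" by blast
    have single: "boundary (G\<lparr>edges := S\<rparr>) (\<lambda>f. of_bool (f = e)) w =
        of_bool (head G e = w) - of_bool (tail G e = w)" for w
      using assms(2) edge(2) boundary_indicator[of "G\<lparr>edges := S\<rparr>" e w] by simp
    \<comment> \<open>The sign is 1 if the path runs along \<open>e\<close> from tail to head, and
      -1 otherwise.\<close>
    obtain r :: real where r: "\<And>w. r * (of_bool (head G e = w) - of_bool (tail G e = w)) =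
        of_bool (y = w) - of_bool (x = w)"
    proof (cases "tail G e = x \<and> head G e = y")
      case True
      then show ?thesis by (intro that[of 1]) auto
    next
      case False
      then show ?thesis using edge(3) by (intro that[of "- 1"]) auto
    qed
    show ?case
      by (rule exI[of _ "\<lambda>f. p f + r * of_bool (f = e)"])
        (use p edge(2) in \<open>auto simp: boundary_add single r\<close>)
  qed
  then show ?thesis using that by blast
qed

text \<open>Each edge of \<open>S\<close> has both endpoints or neither in the component of
  \<open>tail G f\<close>, so its contributions cancel. Only \<open>f\<close> leaves the component.
  Hence the coefficient of a bridge is 0 in every cycle.\<close>

lemma boundary_sum_joined:
  assumes "finite S" "\<And>e. e \<in> S \<Longrightarrow> tail G e \<in> verts G \<and> head G e \<in> verts G"
    and "finite (verts G)" "(tail G f, head G f) \<notin> joined G S" "f \<notin> S"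
    and "tail G f \<in> verts G" "head G f \<in> verts G"
  shows "(\<Sum>w\<in>{w\<in>verts G. (tail G f, w) \<in> joined G S}. boundary (G\<lparr>edges := insert f S\<rparr>) c w) = - c f"
proof -
  let ?C = "{w\<in>verts G. (tail G f, w) \<in> joined G S}"
  have "(\<Sum>w\<in>?C. boundary (G\<lparr>edges := insert f S\<rparr>) c w) =
      (\<Sum>e\<in>insert f S. c e * (\<Sum>w\<in>?C. of_bool (head G e = w) - of_bool (tail G e = w)))"
    unfolding boundary_def by (simp add: sum_distrib_left sum.swap[of _ _ ?C])
  also have "\<dots> = (\<Sum>e\<in>insert f S. c e * (of_bool (head G e \<in> ?C) - of_bool (tail G e \<in> ?C)))"
    using assms(3) by (simp add: sum_subtractf of_bool_def sum.delta)
  also have "\<dots> = (\<Sum>e\<in>{f}. c e * (of_bool (head G e \<in> ?C) - of_bool (tail G e \<in> ?C)))"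
  proof (rule sum.mono_neutral_right)
    show "\<forall>e\<in>insert f S - {f}. c e * (of_bool (head G e \<in> ?C) - of_bool (tail G e \<in> ?C)) = 0"
    proof
      fix e assume "e \<in> insert f S - {f}"
      then have "e \<in> S" by simp
      then have "(tail G e, head G e) \<in> joined G S" "(head G e, tail G e) \<in> joined G S"
        using joined_edge joined_sym by metis+
      then have "head G e \<in> ?C \<longleftrightarrow> tail G e \<in> ?C"
        using assms(2)[OF \<open>e \<in> S\<close>] by (blast intro: joined_trans)
      then show "c e * (of_bool (head G e \<in> ?C) - of_bool (tail G e \<in> ?C)) = 0" by simp
    qed
  qed (use assms(1) in auto)
  also have "\<dots> = - c f" using assms(4,6) by simp
  finally show ?thesis .
qed

text \<open>Edges are added one at a time. An edge between joined vertices closes a cycle and raises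
  the dimension by one; any other edge leaves the cycle space alone and lowers the number of
  components by one. An explicit finite basis is carried along so that the new cycle can be adjoined
  to it.\<close>

lemma cycle_space_basis:
  assumes "well_formed G" "S \<subseteq> edges G"
  shows "\<exists>B. finite B \<and> chains.independent B \<and> chains.span B = cycle_space (G\<lparr>edges := S\<rparr>) \<and>
    card B + card (verts G) = card S + ncomp G S"
proof -
  have "finite S" using assms finite_subset by (auto simp: well_formed_def)
  then show ?thesis using assms(2)
  proof (induction S rule: finite_induct)
    case empty
    have "cycle_space (G\<lparr>edges := {}\<rparr>) = {0}"
      by (auto simp: cycle_space_def boundary_def fun_eq_iff)
    then show ?case by (intro exI[of _ "{}"]) (simp add: ncomp_empty chains.dependent_def)
  next
    case (insert f S)
    then obtain B where B: "finite B" "chains.independent B"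
      "chains.span B = cycle_space (G\<lparr>edges := S\<rparr>)"
      "card B + card (verts G) = card S + ncomp G S" by auto
    have f: "tail G f \<in> verts G" "head G f \<in> verts G" "finite (verts G)"
      using assms(1) insert.prems by (auto simp: well_formed_def)
    have cycle_insert: "c \<in> cycle_space (G\<lparr>edges := S\<rparr>)"
      if c: "c \<in> cycle_space (G\<lparr>edges := insert f S\<rparr>)" "c f = 0" for c
    proof -
      have supp: "c e = 0" if "e \<notin> S" for e
        using c that by (cases "e = f") (auto simp: cycle_space_def)
      then have "boundary (G\<lparr>edges := S\<rparr>) c v = boundary (G\<lparr>edges := insert f S\<rparr>) c v" for v
        using insert.hyps by (intro boundary_support) auto
      then show ?thesis using c(1) supp by (simp add: cycle_space_def)
    qed
    have cycle_mono: "c \<in> cycle_space (G\<lparr>edges := insert f S\<rparr>)"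
      if "c \<in> cycle_space (G\<lparr>edges := S\<rparr>)" for c
      using that insert.hyps
        boundary_support[of "insert f S" S c G, OF _ subset_insertI]
      by (auto simp: cycle_space_def)
    show ?case
    proof (cases "(tail G f, head G f) \<in> joined G S")
      case True
      obtain p where p: "\<And>e. e \<notin> S \<Longrightarrow> p e = 0"
        "\<And>w. boundary (G\<lparr>edges := S\<rparr>) p w = of_bool (head G f = w) - of_bool (tail G f = w)"
        using joined_boundary[OF True insert.hyps(1)] by blast
      \<comment> \<open>The new edge minus a path through \<open>S\<close> with the same boundary: a
        cycle whose coefficient at \<open>f\<close> is 1.\<close>
      define z where "z = (\<lambda>e. of_bool (e = f) + - 1 * p e)"
      have zf: "z f = 1" using p(1)[OF insert.hyps(2)] by (simp add: z_def)
      have "boundary (G\<lparr>edges := insert f S\<rparr>) p w = of_bool (head G f = w) - of_bool (tail G f = w)"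
        for w using p boundary_support[of "insert f S" S p G w, OF _ subset_insertI] insert.hyps
        by simp
      moreover have "boundary (G\<lparr>edges := insert f S\<rparr>) (\<lambda>e. of_bool (e = f)) w =
          of_bool (head G f = w) - of_bool (tail G f = w)" for w
        using insert.hyps boundary_indicator[of "G\<lparr>edges := insert f S\<rparr>" f w] by simp
      ultimately have "boundary (G\<lparr>edges := insert f S\<rparr>) z w = 0" for w
        unfolding z_def boundary_add by simp
      then have z: "z \<in> cycle_space (G\<lparr>edges := insert f S\<rparr>)"
        using p(1) by (simp add: cycle_space_def z_def)
      have combine: "(\<lambda>e. c e + r * z e) \<in> cycle_space (G\<lparr>edges := insert f S\<rparr>)"
        if "c \<in> cycle_space (G\<lparr>edges := insert f S\<rparr>)" for c r
        using that z by (simp add: cycle_space_def boundary_add)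
      have "chains.span (insert z B) = cycle_space (G\<lparr>edges := insert f S\<rparr>)"
      proof (intro equalityI subsetI)
        fix c assume "c \<in> chains.span (insert z B)"
        then obtain k where "c - (\<lambda>e. k * z e) \<in> cycle_space (G\<lparr>edges := S\<rparr>)"
          unfolding chains.span_insert B(3) by blast
        from combine[OF cycle_mono[OF this], of k]
        show "c \<in> cycle_space (G\<lparr>edges := insert f S\<rparr>)" by simp
      next
        fix c assume "c \<in> cycle_space (G\<lparr>edges := insert f S\<rparr>)"
        \<comment> \<open>Subtracting this multiple of \<open>z\<close> removes the coefficient at
          \<open>f\<close>, which leaves a cycle of \<open>S\<close>.\<close>
        then have "(\<lambda>e. c e + (- c f) * z e) \<in> cycle_space (G\<lparr>edges := S\<rparr>)"
          by (intro cycle_insert combine) (simp_all add: zf)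
        moreover have "(\<lambda>e. c e + (- c f) * z e) = c - (\<lambda>e. c f * z e)"
          by (simp add: fun_eq_iff)
        ultimately show "c \<in> chains.span (insert z B)"
          unfolding chains.span_insert B(3) by auto
      qed
      moreover have "z \<notin> chains.span B"
        using zf insert.hyps(2) unfolding B(3) by (auto simp: cycle_space_def)
      moreover from this have "z \<notin> B" using chains.span_base by blast
      ultimately show ?thesis
        using B insert.hyps ncomp_insert_joined[OF True]
        by (intro exI[of _ "insert z B"]) (simp add: chains.independent_insert)
    next
      case False
      \<comment> \<open>Here \<open>f\<close> is a bridge: the boundary of a cycle sums to 0 over
        the component of \<open>tail G f\<close>, and this sum is \<open>- c f\<close>.\<close>
      have "c f = 0" if "c \<in> cycle_space (G\<lparr>edges := insert f S\<rparr>)" for c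
        using boundary_sum_joined[OF insert.hyps(1) _ f(3) False insert.hyps(2) f(1,2), of c]
          that assms(1) insert.prems
        by (auto simp: cycle_space_def well_formed_def subset_iff)
      then have "cycle_space (G\<lparr>edges := insert f S\<rparr>) = cycle_space (G\<lparr>edges := S\<rparr>)"
        using cycle_insert cycle_mono by blast
      then show ?thesis
        using B insert.hyps ncomp_insert_not_joined[OF f(3,1,2) False]
        by (intro exI[of _ B]) simp
    qed
  qed
qed

theorem euler_formula:
  assumes "well_formed G" "S \<subseteq> edges G"
  shows "loop_number (G\<lparr>edges := S\<rparr>) + card (verts G) = card S + ncomp G S"
proof -
  obtain B where B: "chains.independent B" "chains.span B = cycle_space (G\<lparr>edges := S\<rparr>)"
    "card B + card (verts G) = card S + ncomp G S"
    using cycle_space_basis[OF assms] by blast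
  have "chains.dim (cycle_space (G\<lparr>edges := S\<rparr>)) = card B"
    using chains.dim_eq_card[of B "cycle_space (G\<lparr>edges := S\<rparr>)"] B(1,2)
    by (metis chains.span_span)
  then show ?thesis using B(3) by (simp add: loop_number_def)
qed

text \<open>Euler's formula replaces the vanishing of the loop number by an edge count. The counts
  are written additively to avoid truncated subtraction.\<close>

lemma spanning_trees_iff:
  assumes "well_formed G"
  shows "T \<in> spanning_trees k G \<longleftrightarrow> T \<subseteq> edges G \<and> card T + k = card (verts G) \<and> ncomp G T = k"
  using euler_formula[OF assms, of T] by (auto simp: spanning_trees_def ncomp_def)

section \<open>Forest sums and the polynomial \<open>\<Psi>\<close>\<close>

text \<open>The common shape of \<Psi> (weight 1) and \<Phi> (weight the squared momentum), so that
  one set of lemmas factors both. The family is arbitrary, so leading part and remainder have this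
  shape too.\<close>

definition forest_sum :: "('e set \<Rightarrow> real) \<Rightarrow> 'e set \<Rightarrow> 'e set set \<Rightarrow> 'e edge_poly" where
  "forest_sum w X \<F> = (\<Sum>T\<in>\<F>. const (w T) * (\<Prod>e\<in>X - T. \<alpha> e))"

lemma const_0 [simp]: "const 0 = 0"
  by (simp add: const_def)

lemma const_1 [simp]: "const 1 = 1"
  by (simp add: const_def)

lemma const_mult: "const (a * b) = const a * const b"
  by (simp add: const_def mult_single)

text \<open>The map \<open>T \<mapsto> (T \<inter> X, T \<inter> Y)\<close> is a bijection onto the
  product of the two families, and the complement of \<open>T\<close>, hence its monomial, splits in
  the same way.\<close>

lemma forest_sum_union:
  assumes "finite X" "finite Y" "X \<inter> Y = {}" "\<F> \<subseteq> Pow (X \<union> Y)" "\<A> \<subseteq> Pow X" "\<B> \<subseteq> Pow Y"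
    and "\<And>T. T \<subseteq> X \<union> Y \<Longrightarrow> T \<in> \<F> \<longleftrightarrow> T \<inter> X \<in> \<A> \<and> T \<inter> Y \<in> \<B>"
    and "\<And>T. T \<in> \<F> \<Longrightarrow> w T = u (T \<inter> X) * v (T \<inter> Y)"
  shows "forest_sum w (X \<union> Y) \<F> = forest_sum u X \<A> * forest_sum v Y \<B>"
proof -
  have "forest_sum u X \<A> * forest_sum v Y \<B> =
      (\<Sum>(A, B)\<in>\<A> \<times> \<B>. const (u A) * (\<Prod>e\<in>X - A. \<alpha> e) * (const (v B) * (\<Prod>e\<in>Y - B. \<alpha> e)))"
    unfolding forest_sum_def sum_product by (simp add: sum.cartesian_product)
  also have "\<dots> = forest_sum w (X \<union> Y) \<F>"
    unfolding forest_sum_def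
  proof (rule sum.reindex_bij_witness[of _ "\<lambda>T. (T \<inter> X, T \<inter> Y)" "\<lambda>(A, B). A \<union> B"])
    fix p assume "p \<in> \<A> \<times> \<B>"
    then obtain A B where p: "p = (A, B)" "A \<in> \<A>" "B \<in> \<B>" by auto
    then have AB: "A \<subseteq> X" "B \<subseteq> Y" using assms(5,6) by auto
    then have int: "(A \<union> B) \<inter> X = A" "(A \<union> B) \<inter> Y = B" using assms(3) by auto
    then show "((case p of (A, B) \<Rightarrow> A \<union> B) \<inter> X, (case p of (A, B) \<Rightarrow> A \<union> B) \<inter> Y) = p"
      using p by simp
    have mem: "A \<union> B \<in> \<F>" using assms(7)[of "A \<union> B"] AB int p by auto
    then show "(case p of (A, B) \<Rightarrow> A \<union> B) \<in> \<F>" using p by simp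
    have "X \<union> Y - (A \<union> B) = (X - A) \<union> (Y - B)" using AB assms(3) by auto
    then have "(\<Prod>e\<in>X \<union> Y - (A \<union> B). \<alpha> e) = (\<Prod>e\<in>X - A. \<alpha> e) * (\<Prod>e\<in>Y - B. \<alpha> e)"
      using assms(1-3) by (simp add: prod.union_disjoint Int_Diff disjoint_iff)
    then show "const (w (case p of (A, B) \<Rightarrow> A \<union> B)) * (\<Prod>e\<in>X \<union> Y - (case p of (A, B) \<Rightarrow> A \<union> B). \<alpha> e) =
        (case p of (A, B) \<Rightarrow>
          const (u A) * (\<Prod>e\<in>X - A. \<alpha> e) * (const (v B) * (\<Prod>e\<in>Y - B. \<alpha> e)))"
      using assms(8)[OF mem] int p by (simp add: const_mult mult_ac)
  next
    fix T assume "T \<in> \<F>"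
    then show "(case (T \<inter> X, T \<inter> Y) of (A, B) \<Rightarrow> A \<union> B) = T" "(T \<inter> X, T \<inter> Y) \<in> \<A> \<times> \<B>"
      using assms(4,7) by auto
  qed
  finally show ?thesis by simp
qed

section \<open>Splitting a graph along a union of components\<close>

lemma quotient_union_disjoint:
  assumes "equiv A R" "equiv B R'" "A \<inter> B = {}"
  shows "(A \<union> B) // (R \<union> R') = A // R \<union> B // R'" "A // R \<inter> B // R' = {}"
proof -
  have R: "(R \<union> R') `` {v} = R `` {v}" if "v \<in> A" for v
    using that assms equiv_type[OF assms(2)] by blast
  have R': "(R \<union> R') `` {v} = R' `` {v}" if "v \<in> B" for v
    using that assms equiv_type[OF assms(1)] by blast
  show "(A \<union> B) // (R \<union> R') = A // R \<union> B // R'"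
    unfolding quotient_image image_Un using R R' by (simp cong: image_cong)
  show "A // R \<inter> B // R' = {}"
  proof (rule ccontr)
    assume "A // R \<inter> B // R' \<noteq> {}"
    then obtain C where C: "C \<in> A // R" "C \<in> B // R'" by blast
    then have "C \<subseteq> A" "C \<subseteq> B" "C \<noteq> {}"
      using in_quotient_imp_subset[OF assms(1)] in_quotient_imp_subset[OF assms(2)]
        in_quotient_imp_non_empty[OF assms(1)] by auto
    then show False using assms(3) by blast
  qed
qed

text \<open>No edge leaves \<open>A\<close>, so \<open>A\<close> is a union of components. Unlike
  single components, such sets are closed under complement, which allows components to be split off
  one by one.\<close>

definition separated :: "('v, 'e, 'x, 'd :: finite) fgraph \<Rightarrow> 'v set \<Rightarrow> bool" where
  "separated G A \<longleftrightarrow> A \<subseteq> verts G \<and> (\<forall>e\<in>edges G. tail G e \<in> A \<longleftrightarrow> head G e \<in> A)"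

lemma induced_simps [simp]:
  "verts (induced G A) = A"
  "edges (induced G A) = {e\<in>edges G. tail G e \<in> A \<and> head G e \<in> A}"
  "tail (induced G A) = tail G" "head (induced G A) = head G"
  "legs (induced G A) = {i\<in>legs G. leg_at G i \<in> A}" "leg_at (induced G A) = leg_at G"
  "momentum (induced G A) = momentum G"
  by (simp_all add: induced_def)

lemma well_formed_induced: "well_formed G \<Longrightarrow> separated G A \<Longrightarrow> well_formed (induced G A)"
  using finite_subset by (auto simp: well_formed_def separated_def)

lemma separated_Diff: "well_formed G \<Longrightarrow> separated G A \<Longrightarrow> separated G (verts G - A)"
  by (auto simp: separated_def well_formed_def)

lemma joined_induced: "joined (induced G A) S = joined G S"
  by (simp add: joined_def adj_def)

lemma edges_separated:
  assumes "well_formed G" "separated G A"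
  shows "edges G = edges (induced G A) \<union> edges (induced G (verts G - A))"
    and "edges (induced G A) \<inter> edges (induced G (verts G - A)) = {}"
  using assms by (auto simp: separated_def well_formed_def)

text \<open>A path that starts in \<open>A\<close> stays in \<open>A\<close> and so uses only edges
  with both endpoints there.\<close>

lemma joined_separated:
  assumes "separated G A" "S \<subseteq> edges G" "u \<in> A" "(u, v) \<in> joined G S"
  shows "v \<in> A \<and> (u, v) \<in> joined G (S \<inter> edges (induced G A))"
  using assms(4)
proof (induction rule: joined_induct)
  case base
  then show ?case using assms(3) by simp
next
  case (edge x y e)
  then have A: "tail G e \<in> A" "head G e \<in> A"
    using assms(1,2) by (auto simp: separated_def)
  then have "e \<in> S \<inter> edges (induced G A)" using assms(2) edge(2) by auto
  then have "(tail G e, head G e) \<in> joined G (S \<inter> edges (induced G A))" by (rule joined_edge)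
  then have "(x, y) \<in> joined G (S \<inter> edges (induced G A))"
    using edge(3) joined_sym by auto
  then show ?case using A edge(3,4) joined_trans by metis
qed

lemma joined_verts_separated:
  assumes "well_formed G" "separated G A" "S \<subseteq> edges G"
  shows "joined_verts G S = joined_verts (induced G A) (S \<inter> edges (induced G A)) \<union>
    joined_verts (induced G (verts G - A)) (S \<inter> edges (induced G (verts G - A)))"
    (is "_ = ?A \<union> ?B")
proof
  show "joined_verts G S \<subseteq> ?A \<union> ?B"
  proof clarify
    fix u v assume uv: "(u, v) \<in> joined_verts G S" "(u, v) \<notin> ?B"
    show "(u, v) \<in> ?A"
    proof (cases "u \<in> A")
      case True
      then show ?thesis
        using joined_separated[OF assms(2,3)] uv(1)
        unfolding joined_verts_def joined_induced by auto
    next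
      case False
      then have "u \<in> verts G - A" using uv(1) by (simp add: joined_verts_def)
      moreover have "(u, v) \<in> joined G S" using uv(1) by (simp add: joined_verts_def)
      ultimately have "(u, v) \<in> ?B"
        using joined_separated[OF separated_Diff[OF assms(1,2)] assms(3)]
        unfolding joined_verts_def joined_induced induced_simps(1) by blast
      then show ?thesis using uv(2) by blast
    qed
  qed
  have "joined G (S \<inter> edges (induced G D)) \<subseteq> joined G S" for D
    by (rule joined_mono) simp
  then show "?A \<union> ?B \<subseteq> joined_verts G S"
    using assms(2) unfolding joined_verts_def joined_induced separated_def induced_simps(1) by blast
qed

lemma components_separated:
  assumes "well_formed G" "separated G A" "S \<subseteq> edges G"
  shows "components (G\<lparr>edges := S\<rparr>) =
      components (induced G A\<lparr>edges := S \<inter> edges (induced G A)\<rparr>) \<union>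
      components (induced G (verts G - A)\<lparr>edges := S \<inter> edges (induced G (verts G - A))\<rparr>)"
    and "components (induced G A\<lparr>edges := S \<inter> edges (induced G A)\<rparr>) \<inter>
      components (induced G (verts G - A)\<lparr>edges := S \<inter> edges (induced G (verts G - A))\<rparr>) = {}"
proof -
  have eq: "equiv A (joined_verts (induced G A) T)"
    "equiv (verts G - A) (joined_verts (induced G (verts G - A)) T)" for T
    using equiv_joined_verts[of "induced G A"] equiv_joined_verts[of "induced G (verts G - A)"]
    by simp_all
  have V: "verts G = A \<union> (verts G - A)" using assms(2) by (auto simp: separated_def)
  note q = quotient_union_disjoint[OF eq Diff_disjoint]
  show "components (G\<lparr>edges := S\<rparr>) =
      components (induced G A\<lparr>edges := S \<inter> edges (induced G A)\<rparr>) \<union>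
      components (induced G (verts G - A)\<lparr>edges := S \<inter> edges (induced G (verts G - A))\<rparr>)"
    unfolding components_edges joined_verts_separated[OF assms] induced_simps(1) q(1)[symmetric]
    using V by simp
  show "components (induced G A\<lparr>edges := S \<inter> edges (induced G A)\<rparr>) \<inter>
      components (induced G (verts G - A)\<lparr>edges := S \<inter> edges (induced G (verts G - A))\<rparr>) = {}"
    unfolding components_edges induced_simps(1) by (rule q(2))
qed

lemma finite_components: "finite (verts G) \<Longrightarrow> finite (components (G\<lparr>edges := S\<rparr>))"
  unfolding components_edges by (rule finite_quotient[OF _ equiv_type[OF equiv_joined_verts]])

lemma ncomp_separated:
  assumes "well_formed G" "separated G A" "S \<subseteq> edges G"
  shows "ncomp G S = ncomp (induced G A) (S \<inter> edges (induced G A)) +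
    ncomp (induced G (verts G - A)) (S \<inter> edges (induced G (verts G - A)))"
proof -
  have "finite A" "finite (verts G - A)"
    using assms(1,2) finite_subset by (auto simp: well_formed_def separated_def)
  then show ?thesis
    unfolding ncomp_def components_separated(1)[OF assms]
    by (intro card_Un_disjoint finite_components components_separated(2)[OF assms]) simp_all
qed

lemma components_quotient: "components G = verts G // joined_verts G (edges G)"
  using components_edges[of "edges G" G] by simp

lemma separated_component:
  assumes "well_formed G" "C \<in> components G"
  shows "separated G C"
proof -
  obtain v where v: "v \<in> verts G" "C = joined_verts G (edges G) `` {v}"
    using assms(2) unfolding components_quotient by (auto simp: quotient_def)
  have "tail G e \<in> C \<longleftrightarrow> head G e \<in> C" if "e \<in> edges G" for e
    using joined_edge[OF that, of G] joined_sym[OF joined_edge[OF that, of G]] that assms(1)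
    unfolding v joined_verts_def well_formed_def by (auto intro: joined_trans)
  then show ?thesis using v by (auto simp: separated_def joined_verts_def)
qed

text \<open>The components of \<open>G\<close> are those of the two parts, disjointly. One inside
  \<open>C\<close> is a nonempty class contained in the class \<open>C\<close>, hence equal to
  it.\<close>

lemma components_induced_component:
  assumes "well_formed G" "C \<in> components G"
  shows "components (induced G C) = {C}"
    and "components (induced G (verts G - C)) = components G - {C}"
proof -
  let ?A = "components (induced G C)" and ?B = "components (induced G (verts G - C))"
  note sep = separated_component[OF assms]
  have "edges G \<inter> edges (induced G D) = edges (induced G D)" for D by auto
  then have same: "induced G D\<lparr>edges := edges G \<inter> edges (induced G D)\<rparr> = induced G D" for D by simp
  have split: "components G = ?A \<union> ?B" "?A \<inter> ?B = {}"
    using components_separated[OF assms(1) sep order_refl] unfolding same by simp_all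
  have nonempty: "D \<noteq> {}" if "D \<in> components G" for D
    using that in_quotient_imp_non_empty[OF equiv_joined_verts] unfolding components_quotient by blast
  have sub: "D \<subseteq> X" if "D \<in> components (induced G X)" for D X
    using that in_quotient_imp_subset[OF equiv_joined_verts[of "induced G X"]]
    unfolding components_quotient by auto
  have disj: "D = C \<or> D \<inter> C = {}" if "D \<in> components G" for D
    using that assms(2) quotient_disj[OF equiv_joined_verts] unfolding components_quotient by blast
  have "D = C" if "D \<in> ?A" for D
  proof -
    have "D \<in> components G" "D \<subseteq> C" using that split(1) sub[of D C] by simp_all
    then show ?thesis using disj[of D] nonempty[of D] by blast
  qed
  moreover have "C \<notin> ?B" using sub[of C "verts G - C"] nonempty[OF assms(2)] by blast
  ultimately show "?A = {C}" "?B = components G - {C}"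
    using split assms(2) by blast+
qed

lemma induced_induced: "A \<subseteq> B \<Longrightarrow> induced (induced G B) A = induced G A"
  unfolding induced_def by (auto intro!: arg_cong2[where f = "\<lambda>E L. G\<lparr>verts := A, edges := E, legs := L\<rparr>"])

text \<open>Vertices, edges and component numbers all add up over the two parts. Since loop numbers
  are nonnegative, each part satisfies an Euler inequality, and equality for the sum forces equality
  in both. The excess \<open>j\<close> is 0 for \<Psi> and 1 for \<Phi>.\<close>

lemma spanning_trees_separated:
  assumes "well_formed G" "separated G A" "T \<subseteq> edges G"
    and "ka = card (components (induced G A)) + j" "kb = card (components (induced G (verts G - A)))"
  shows "T \<in> spanning_trees (ka + kb) G \<and>
      ncomp (induced G (verts G - A)) (T \<inter> edges (induced G (verts G - A))) = kb \<longleftrightarrow>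
    T \<inter> edges (induced G A) \<in> spanning_trees ka (induced G A) \<and>
    T \<inter> edges (induced G (verts G - A)) \<in> spanning_trees kb (induced G (verts G - A))"
proof -
  let ?X = "edges (induced G A)" and ?Y = "edges (induced G (verts G - A))"
  note wfA = well_formed_induced[OF assms(1,2)]
  note wfB = well_formed_induced[OF assms(1) separated_Diff[OF assms(1,2)]]
  have fin: "finite T" "finite (verts G)"
    using assms(1,3) finite_subset by (auto simp: well_formed_def)
  have "T = (T \<inter> ?X) \<union> (T \<inter> ?Y)" using assms(3) edges_separated(1)[OF assms(1,2)] by blast
  then have cardT: "card T = card (T \<inter> ?X) + card (T \<inter> ?Y)"
    using card_Un_disjoint[of "T \<inter> ?X" "T \<inter> ?Y"] fin edges_separated(2)[OF assms(1,2)] by force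
  have cardV: "card (verts G) = card A + card (verts G - A)"
    using assms(2) fin by (metis add.commute card_Diff_subset card_mono finite_subset le_add_diff_inverse2 separated_def)
  have euler: "card A \<le> card (T \<inter> ?X) + ncomp (induced G A) (T \<inter> ?X)"
    "card (verts G - A) \<le> card (T \<inter> ?Y) + ncomp (induced G (verts G - A)) (T \<inter> ?Y)"
    using euler_formula[OF wfA Int_lower2[of T]] euler_formula[OF wfB Int_lower2[of T]] by simp_all
  show ?thesis
    unfolding spanning_trees_iff[OF assms(1)] spanning_trees_iff[OF wfA] spanning_trees_iff[OF wfB]
      ncomp_separated[OF assms(1-3)] cardT cardV induced_simps(1)
    using euler assms(3) by auto
qed

text \<open>The condition on \<open>ncomp\<close> demands that the extra cuts fall inside
  \<open>A\<close>; for \<Phi> there are forests of \<open>G\<close> that violate it, and their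
  weights have to be treated separately.\<close>

lemma forest_sum_separated:
  assumes "well_formed G" "separated G A"
    and "ka = card (components (induced G A)) + j" "kb = card (components (induced G (verts G - A)))"
    and "\<And>T. T \<subseteq> edges G \<Longrightarrow> w T = u (T \<inter> edges (induced G A))"
  shows "forest_sum w (edges G) {T \<in> spanning_trees (ka + kb) G.
      ncomp (induced G (verts G - A)) (T \<inter> edges (induced G (verts G - A))) = kb} =
    forest_sum u (edges (induced G A)) (spanning_trees ka (induced G A)) *
    forest_sum (\<lambda>_. 1) (edges (induced G (verts G - A))) (spanning_trees kb (induced G (verts G - A)))"
proof -
  let ?X = "edges (induced G A)" and ?Y = "edges (induced G (verts G - A))"
  have "finite (edges G)" using assms(1) by (simp add: well_formed_def)
  then have fin: "finite ?X" "finite ?Y" by simp_all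
  note E = edges_separated[OF assms(1,2)]
  have "forest_sum w (?X \<union> ?Y) {T \<in> spanning_trees (ka + kb) G.
      ncomp (induced G (verts G - A)) (T \<inter> ?Y) = kb} =
    forest_sum u ?X (spanning_trees ka (induced G A)) *
    forest_sum (\<lambda>_. 1) ?Y (spanning_trees kb (induced G (verts G - A)))"
  proof (rule forest_sum_union[OF fin E(2)])
    show "{T \<in> spanning_trees (ka + kb) G. ncomp (induced G (verts G - A)) (T \<inter> ?Y) = kb}
        \<subseteq> Pow (?X \<union> ?Y)"
      using E(1) by (auto simp: spanning_trees_def)
    show "spanning_trees ka (induced G A) \<subseteq> Pow ?X"
      "spanning_trees kb (induced G (verts G - A)) \<subseteq> Pow ?Y"
      by (auto simp: spanning_trees_def)
    fix T
    show "T \<in> {T \<in> spanning_trees (ka + kb) G. ncomp (induced G (verts G - A)) (T \<inter> ?Y) = kb} \<longleftrightarrow>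
      T \<inter> ?X \<in> spanning_trees ka (induced G A) \<and>
      T \<inter> ?Y \<in> spanning_trees kb (induced G (verts G - A))" if "T \<subseteq> ?X \<union> ?Y"
      using spanning_trees_separated[OF assms(1,2) that[folded E(1)] assms(3,4)] by blast
    show "w T = u (T \<inter> ?X) * 1"
      if "T \<in> {T \<in> spanning_trees (ka + kb) G. ncomp (induced G (verts G - A)) (T \<inter> ?Y) = kb}"
      using assms(5)[of T] that by (simp add: spanning_trees_def)
  qed
  then show ?thesis unfolding E(1)[symmetric] .
qed

lemma ncomp_ge_components:
  assumes "finite (verts G)" "S \<subseteq> edges G"
  shows "card (components G) \<le> ncomp G S"
  using ncomp_antimono(1)[OF assms] by (simp add: ncomp_edges)

lemma \<Psi>_conn_forest_sum: "\<Psi>_conn G = forest_sum (\<lambda>_. 1) (edges G) (spanning_trees 1 G)"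
  by (simp add: \<Psi>_conn_def forest_sum_def)

lemma prod_\<Psi>_conn_induced:
  assumes "well_formed G" "C \<in> components G"
  shows "(\<Prod>D\<in>components G - {C}. \<Psi>_conn (induced G D)) = \<Psi> (induced G (verts G - C))"
  unfolding \<Psi>_def components_induced_component(2)[OF assms]
proof (rule prod.cong)
  fix D assume D: "D \<in> components G - {C}"
  then have "D \<subseteq> verts G - C"
    using in_quotient_imp_subset[OF equiv_joined_verts[of "induced G (verts G - C)"]]
      components_induced_component(2)[OF assms]
    unfolding components_quotient[of "induced G _"] by auto
  then show "\<Psi>_conn (induced G D) = \<Psi>_conn (induced (induced G (verts G - C)) D)"
    by (simp add: induced_induced)
qed simp

text \<open>Induction on the number of components, splitting off one of them. In the base case there
  are no vertices, and the empty product agrees with the single empty forest.\<close>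

theorem \<Psi>_forest_sum:
  assumes "well_formed G"
  shows "\<Psi> G = forest_sum (\<lambda>_. 1) (edges G) (spanning_trees (card (components G)) G)"
  using assms
proof (induction "card (components G)" arbitrary: G)
  case 0
  have fin: "finite (components G)"
    using finite_components[of G "edges G"] 0(2) by (simp add: well_formed_def)
  then have "components G = {}" using 0 by simp
  then have "verts G = {}" unfolding components_quotient by simp
  then have "edges G = {}" using 0 by (auto simp: well_formed_def)
  moreover have "spanning_trees 0 G = {{}}"
    using \<open>verts G = {}\<close> \<open>edges G = {}\<close> spanning_trees_iff[OF 0(2), of _ 0] ncomp_empty[of G]
    by auto
  ultimately show ?case
    using \<open>components G = {}\<close> by (simp add: \<Psi>_def forest_sum_def)
next
  case (Suc n)
  have fin: "finite (components G)" "finite (verts G)"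
    using finite_components[of G "edges G"] Suc.prems by (simp_all add: well_formed_def)
  obtain C where C: "C \<in> components G" using Suc.hyps(2) by fastforce
  let ?B = "induced G (verts G - C)"
  note ind = components_induced_component[OF Suc.prems C]
  note sep = separated_component[OF Suc.prems C]
  note sepB = separated_Diff[OF Suc.prems sep]
  have cards: "card (components (induced G C)) = 1" "card (components ?B) = n"
    using ind C fin Suc.hyps(2) by simp_all
  have "\<Psi> G = \<Psi>_conn (induced G C) * \<Psi> ?B"
    unfolding prod_\<Psi>_conn_induced[OF Suc.prems C, symmetric] \<Psi>_def[of G]
    using fin C by (simp add: prod.remove)
  also have "\<Psi> ?B = forest_sum (\<lambda>_. 1) (edges ?B) (spanning_trees n ?B)"
    using Suc.hyps(1)[OF cards(2)[symmetric] well_formed_induced[OF Suc.prems sepB]] cards by simp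
  also have "\<Psi>_conn (induced G C) * \<dots> = forest_sum (\<lambda>_. 1) (edges G)
      {T \<in> spanning_trees (1 + n) G. ncomp ?B (T \<inter> edges ?B) = n}"
    unfolding \<Psi>_conn_forest_sum
    by (rule forest_sum_separated[OF Suc.prems sep, of 1 0 n, symmetric]) (simp_all add: cards)
  also have "{T \<in> spanning_trees (1 + n) G. ncomp ?B (T \<inter> edges ?B) = n} =
      spanning_trees (card (components G)) G"
  proof -
    \<comment> \<open>The parts have at least 1 and \<open>n\<close> components, and
      \<open>1 + n\<close> together, so neither has more.\<close>
    have "ncomp ?B (T \<inter> edges ?B) = n" if "T \<in> spanning_trees (1 + n) G" for T
    proof -
      have T: "T \<subseteq> edges G" "ncomp G T = 1 + n"
        using that by (auto simp: spanning_trees_iff[OF Suc.prems])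
      have "finite C" using sep fin finite_subset by (auto simp: separated_def)
      then have "1 \<le> ncomp (induced G C) (T \<inter> edges (induced G C))"
        using ncomp_ge_components[of "induced G C" "T \<inter> edges (induced G C)"] cards(1) by simp
      moreover have "n \<le> ncomp ?B (T \<inter> edges ?B)"
        using ncomp_ge_components[of ?B "T \<inter> edges ?B"] cards(2) fin by simp
      ultimately show ?thesis using ncomp_separated[OF Suc.prems sep T(1)] T(2) by simp
    qed
    then show ?thesis using Suc.hyps(2) by auto
  qed
  finally show ?case .
qed

section \<open>The polynomial \<open>\<Phi>\<close>\<close>

text \<open>
  Half the sum of the squared momenta entering the components of \<open>F\<close>, which for a spanning 2-tree is the
  squared momentum of either tree. In this form the weight depends on \<open>F\<close> only through the relation
  \<open>joined\<close> on the attachment vertices, so it transfers to subgraphs and quotients.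
\<close>

definition momentum_weight :: "('v, 'e, 'x, 'd :: finite) fgraph \<Rightarrow> 'e set \<Rightarrow> real" where
  "momentum_weight G F = (\<Sum>i\<in>legs G. \<Sum>j\<in>legs G.
     of_bool ((leg_at G i, leg_at G j) \<in> joined G F) * (momentum G i \<bullet> momentum G j)) / 2"

lemma sum_inner_sum:
  fixes q :: "'x \<Rightarrow> real ^ 'd :: finite"
  shows "(\<Sum>i\<in>I. \<Sum>j\<in>I. c i * c j * (q i \<bullet> q j)) = (\<Sum>i\<in>I. c i *\<^sub>R q i) \<bullet> (\<Sum>i\<in>I. c i *\<^sub>R q i)"
  unfolding inner_sum_left unfolding inner_sum_right by (simp add: mult_ac)

text \<open>The weight is then half the square of the total momentum, which is 0.\<close>

lemma momentum_weight_joined: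
  assumes "(\<Sum>i\<in>legs G. momentum G i) = 0"
    and "\<And>i j. i \<in> legs G \<Longrightarrow> j \<in> legs G \<Longrightarrow> (leg_at G i, leg_at G j) \<in> joined G F"
  shows "momentum_weight G F = 0"
proof -
  have "momentum_weight G F = (\<Sum>i\<in>legs G. \<Sum>j\<in>legs G. 1 * 1 * (momentum G i \<bullet> momentum G j)) / 2"
    unfolding momentum_weight_def using assms(2) by simp
  also have "\<dots> = 0" unfolding sum_inner_sum using assms(1) by simp
  finally show ?thesis .
qed

text \<open>If \<open>q\<close> enters the chosen tree, then \<open>- q\<close> enters the other one
  by momentum conservation, so half the sum of the two squares is the square of
  \<open>q\<close>.\<close>

lemma tree_momentum_sq_eq:
  fixes G :: "('v, 'e, 'x, 'd :: finite) fgraph"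
  assumes "finite (legs G)" "\<And>i. i \<in> legs G \<Longrightarrow> leg_at G i \<in> verts G"
    and "(\<Sum>i\<in>legs G. momentum G i) = 0" "ncomp G F = 2"
  shows "tree_momentum_sq G F = momentum_weight G F"
proof -
  let ?K = "components (G\<lparr>edges := F\<rparr>)"
  note eqv = equiv_joined_verts[of G F]
  define C where "C = (SOME C. C \<in> ?K)"
  have "?K \<noteq> {}" using assms(4) by (auto simp: ncomp_def)
  then have C: "C \<in> ?K" unfolding C_def by (simp add: some_in_eq)
  have "card (?K - {C}) = 1" using C assms(4) by (simp add: ncomp_def)
  then obtain D where "?K - {C} = {D}" by (auto simp: card_1_singleton_iff)
  then have K: "?K = {C, D}" using C by auto
  have cover: "v \<in> C \<or> v \<in> D" if "v \<in> verts G" for v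
    using Union_quotient[OF eqv] that K unfolding components_edges by blast
  have same: "(u, v) \<in> joined_verts G F" if "X \<in> ?K" "u \<in> X" "v \<in> X" for X u v
    using that in_quotient_imp_in_rel[OF eqv] unfolding components_edges by blast
  have closed: "v \<in> X" if "X \<in> ?K" "u \<in> X" "(u, v) \<in> joined_verts G F" for X u v
    using that in_quotient_imp_closed[OF eqv] unfolding components_edges by blast
  have joined: "(u, v) \<in> joined G F \<longleftrightarrow> (u \<in> C \<longleftrightarrow> v \<in> C)" if "u \<in> verts G" "v \<in> verts G" for u v
  proof -
    have "(u, v) \<in> joined_verts G F \<longleftrightarrow> (u \<in> C \<longleftrightarrow> v \<in> C)"
      using same[OF C, of u v] same[of D u v] closed[OF C, of u v] closed[OF C, of v u]
        cover[OF that(1)] cover[OF that(2)] K equivE[OF eqv]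
      by (metis insertI1 insertI2 symD)
    then show ?thesis using that by (simp add: joined_verts_def)
  qed
  define c :: "'x \<Rightarrow> real" where "c = (\<lambda>i. of_bool (leg_at G i \<in> C))"
  \<comment> \<open>With the indicator \<open>c\<close> of the chosen tree, two legs are joined iff
    both lie in it or both lie in the other.\<close>
  have bool: "of_bool ((leg_at G i, leg_at G j) \<in> joined G F) = c i * c j + (1 - c i) * (1 - c j)"
    if "i \<in> legs G" "j \<in> legs G" for i j
    using joined[OF assms(2)[OF that(1)] assms(2)[OF that(2)]] by (simp add: c_def)
  have q: "momentum_into G C = (\<Sum>i\<in>legs G. c i *\<^sub>R momentum G i)"
    unfolding momentum_into_def c_def using assms(1)
    by (intro sum.mono_neutral_cong_left) auto
  have q': "(\<Sum>i\<in>legs G. (1 - c i) *\<^sub>R momentum G i) = - momentum_into G C"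
    unfolding q by (simp add: scaleR_left_diff_distrib sum_subtractf assms(3))
  have "momentum_weight G F = ((\<Sum>i\<in>legs G. \<Sum>j\<in>legs G. c i * c j * (momentum G i \<bullet> momentum G j)) +
      (\<Sum>i\<in>legs G. \<Sum>j\<in>legs G. (1 - c i) * (1 - c j) * (momentum G i \<bullet> momentum G j))) / 2"
    unfolding momentum_weight_def sum.distrib[symmetric] using bool
    by (simp add: distrib_right cong: sum.cong)
  also have "\<dots> = momentum_into G C \<bullet> momentum_into G C"
    unfolding sum_inner_sum q' q[symmetric] by simp
  finally show ?thesis by (simp add: tree_momentum_sq_def C_def Let_def)
qed

lemma forest_sum_restrict:
  assumes "finite \<F>" "\<And>T. T \<in> \<F> \<Longrightarrow> \<not> P T \<Longrightarrow> w T = 0"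
  shows "forest_sum w X \<F> = forest_sum w X {T \<in> \<F>. P T}"
  unfolding forest_sum_def using assms by (intro sum.mono_neutral_right) auto

lemma finite_spanning_trees: "finite (edges G) \<Longrightarrow> finite (spanning_trees k G)"
  by (rule finite_subset[of _ "Pow (edges G)"]) (auto simp: spanning_trees_def)

lemma feynman_graph_well_formed: "feynman_graph G \<Longrightarrow> well_formed G"
  by (simp add: feynman_graph_def well_formed_def)

text \<open>The component \<open>C\<close> that carries the legs contributes 2-trees, all others
  contribute spanning trees. The remaining forests in the sum are cut outside \<open>C\<close>; they
  join all legs and have weight 0, so they may be included. Without legs, every weight is 0.\<close>

theorem \<Phi>_forest_sum:
  assumes "feynman_graph G"
  shows "\<Phi> G = forest_sum (momentum_weight G) (edges G) (spanning_trees (card (components G) + 1) G)"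
proof (cases "legs G = {}")
  case True
  then show ?thesis by (simp add: \<Phi>_def forest_sum_def momentum_weight_def)
next
  case False
  note wf = feynman_graph_well_formed[OF assms]
  have legs: "finite (legs G)" "\<And>i. i \<in> legs G \<Longrightarrow> leg_at G i \<in> verts G"
    "(\<Sum>i\<in>legs G. momentum G i) = 0"
    "\<And>i j. i \<in> legs G \<Longrightarrow> j \<in> legs G \<Longrightarrow> \<exists>C\<in>components G. leg_at G i \<in> C \<and> leg_at G j \<in> C"
    using assms by (auto simp: feynman_graph_def)
  have fin: "finite (components G)" "finite (verts G)" "finite (edges G)"
    using finite_components[of G "edges G"] wf by (simp_all add: well_formed_def)
  obtain i where i: "i \<in> legs G" using False by blast
  obtain C where C: "C \<in> components G" "leg_at G i \<in> C" using legs(4)[OF i i] by blast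
  have unique: "D = C" if "D \<in> components G" "leg_at G i \<in> D" for D
    using quotient_disj[OF equiv_joined_verts, of D G "edges G" C] that C
    unfolding components_quotient[symmetric] by blast
  have legsC: "leg_at G j \<in> C" if j: "j \<in> legs G" for j
  proof -
    obtain D where "D \<in> components G" "leg_at G i \<in> D" "leg_at G j \<in> D"
      using legs(4)[OF i j] by blast
    then show ?thesis using unique[of D] by simp
  qed
  have the: "(THE C. C \<in> components G \<and> leg_at G ` legs G \<subseteq> C) = C"
  proof (rule the_equality)
    show "C \<in> components G \<and> leg_at G ` legs G \<subseteq> C" using C(1) legsC by blast
    fix D assume "D \<in> components G \<and> leg_at G ` legs G \<subseteq> D"
    then show "D = C" using unique[of D] i by (simp add: image_subset_iff)
  qed
  note sep = separated_component[OF wf C(1)]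
  note ind = components_induced_component[OF wf C(1)]
  let ?A = "induced G C" and ?B = "induced G (verts G - C)"
  let ?n = "card (components ?B)"
  have card: "card (components G) = 1 + ?n" using ind(2) C(1) fin card_Suc_Diff1 by fastforce
  have cardA: "card (components ?A) = 1" by (simp add: ind(1))
  have wfA: "well_formed ?A" by (rule well_formed_induced[OF wf sep])
  have legsA: "legs ?A = legs G" using legsC by auto
  \<comment> \<open>All legs lie in \<open>C\<close>, and paths between them never leave
    \<open>C\<close>.\<close>
  have weight: "momentum_weight G T = momentum_weight ?A (T \<inter> edges ?A)" if "T \<subseteq> edges G" for T
  proof -
    have "(leg_at G i, leg_at G j) \<in> joined G T \<longleftrightarrow>
        (leg_at G i, leg_at G j) \<in> joined G (T \<inter> edges ?A)" if "i \<in> legs G" for i j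
      using joined_separated[OF sep \<open>T \<subseteq> edges G\<close> legsC[OF that]]
        joined_mono[of "T \<inter> edges ?A" T G] by blast
    then show ?thesis
      unfolding momentum_weight_def legsA joined_induced induced_simps(6,7) by simp
  qed
  have "\<Phi>_conn ?A = forest_sum (momentum_weight ?A) (edges ?A) (spanning_trees 2 ?A)"
    unfolding \<Phi>_conn_def forest_sum_def
  proof (rule sum.cong)
    fix F assume "F \<in> spanning_trees 2 ?A"
    then have "tree_momentum_sq ?A F = momentum_weight ?A F"
      using legs legsC by (intro tree_momentum_sq_eq) (auto simp: legsA spanning_trees_iff[OF wfA] simp del: induced_simps(5))
    then show "const (tree_momentum_sq ?A F) * (\<Prod>e\<in>edges ?A - F. \<alpha> e) =
        const (momentum_weight ?A F) * (\<Prod>e\<in>edges ?A - F. \<alpha> e)" by simp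
  qed simp
  moreover have "(\<Prod>D\<in>components G - {C}. \<Psi>_conn (induced G D)) =
      forest_sum (\<lambda>_. 1) (edges ?B) (spanning_trees ?n ?B)"
    unfolding prod_\<Psi>_conn_induced[OF wf C(1)]
    by (rule \<Psi>_forest_sum[OF well_formed_induced[OF wf separated_Diff[OF wf sep]]])
  ultimately have "\<Phi> G = forest_sum (momentum_weight ?A) (edges ?A) (spanning_trees 2 ?A) *
      forest_sum (\<lambda>_. 1) (edges ?B) (spanning_trees ?n ?B)"
    using False unfolding \<Phi>_def the Let_def by simp
  also have "\<dots> = forest_sum (momentum_weight G) (edges G)
      {T \<in> spanning_trees (2 + ?n) G. ncomp ?B (T \<inter> edges ?B) = ?n}"
    by (rule forest_sum_separated[OF wf sep, of 2 1 ?n, symmetric]) (use weight cardA in simp_all)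
  also have "\<dots> = forest_sum (momentum_weight G) (edges G) (spanning_trees (2 + ?n) G)"
  proof (rule forest_sum_restrict[OF finite_spanning_trees[OF fin(3)], symmetric])
    \<comment> \<open>The extra cut lies outside \<open>C\<close>, so \<open>T\<close> still
      connects \<open>C\<close> and thereby joins all legs.\<close>
    fix T assume T: "T \<in> spanning_trees (2 + ?n) G" "ncomp ?B (T \<inter> edges ?B) \<noteq> ?n"
    then have T': "T \<subseteq> edges G" "ncomp G T = 2 + ?n" by (auto simp: spanning_trees_iff[OF wf])
    have finA: "finite (verts ?A)" "finite (verts ?B)"
      using wfA fin by (simp_all add: well_formed_def)
    have "1 \<le> ncomp ?A (T \<inter> edges ?A)" "?n \<le> ncomp ?B (T \<inter> edges ?B)"
      using ncomp_ge_components[OF finA(1) Int_lower2, of T] cardA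
        ncomp_ge_components[OF finA(2) Int_lower2, of T] by simp_all
    then have "ncomp ?A (T \<inter> edges ?A) = 1"
      using ncomp_separated[OF wf sep T'(1)] T'(2) T(2) by simp
    then have "ncomp ?A (edges ?A) = ncomp ?A (T \<inter> edges ?A)"
      using cardA by (simp add: ncomp_edges del: induced_simps)
    from ncomp_antimono(2)[OF finA(1) Int_lower2 this]
    have rel: "joined_verts ?A (edges ?A) = joined_verts ?A (T \<inter> edges ?A)" .
    have CA: "C \<in> verts ?A // joined_verts ?A (edges ?A)"
      using ind(1) unfolding components_quotient by blast
    have "(u, v) \<in> joined_verts ?A (edges ?A)" if "u \<in> C" "v \<in> C" for u v
      by (rule in_quotient_imp_in_rel[OF equiv_joined_verts CA]) (use that in blast)
    then have "(u, v) \<in> joined G (T \<inter> edges ?A)" if "u \<in> C" "v \<in> C" for u v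
      using that unfolding rel by (simp add: joined_verts_def joined_induced del: induced_simps)
    then have "(leg_at G i, leg_at G j) \<in> joined G T" if "i \<in> legs G" "j \<in> legs G" for i j
      using legsC[OF that(1)] legsC[OF that(2)] joined_mono[OF Int_lower1, of G T "edges ?A"] by blast
    then show "momentum_weight G T = 0" using legs(3) by (intro momentum_weight_joined) auto
  qed
  finally show ?thesis using card by simp
qed

section \<open>Degrees, subgraphs and quotients\<close>

text \<open>With a weak inequality, bounds add under multiplication and 0 is a bound for every
  polynomial. Strict bounds are recovered with \<open>Suc r\<close>.\<close>

definition degree_at_least :: "'e set \<Rightarrow> nat \<Rightarrow> 'e edge_poly \<Rightarrow> bool" where
  "degree_at_least S r p \<longleftrightarrow>
     (\<forall>\<mu>\<in>Poly_Mapping.keys p. r \<le> (\<Sum>e\<in>S. Poly_Mapping.lookup \<mu> e))"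

lemma degree_greater_Suc: "degree_greater S r p \<longleftrightarrow> degree_at_least S (Suc r) p"
  by (simp add: degree_greater_def degree_at_least_def Suc_le_eq)

lemma degree_at_least_0 [simp]: "degree_at_least S 0 p"
  by (simp add: degree_at_least_def)

lemma degree_at_least_mono: "degree_at_least S r p \<Longrightarrow> s \<le> r \<Longrightarrow> degree_at_least S s p"
  by (auto simp: degree_at_least_def)

lemma degree_at_least_add:
  "degree_at_least S r p \<Longrightarrow> degree_at_least S r q \<Longrightarrow> degree_at_least S r (p + q)"
  using Poly_Mapping.keys_add[of p q] unfolding degree_at_least_def by blast

lemma degree_at_least_sum:
  "(\<And>i. i \<in> I \<Longrightarrow> degree_at_least S r (f i)) \<Longrightarrow> degree_at_least S r (sum f I)"
  by (induction I rule: infinite_finite_induct)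
    (auto intro: degree_at_least_add simp: degree_at_least_def[of S r 0])

lemma degree_at_least_mult:
  assumes "degree_at_least S r p" "degree_at_least S s q"
  shows "degree_at_least S (r + s) (p * q)"
  unfolding degree_at_least_def
proof
  fix \<mu> assume "\<mu> \<in> Poly_Mapping.keys (p * q)"
  then obtain a b where ab: "\<mu> = a + b" "a \<in> Poly_Mapping.keys p" "b \<in> Poly_Mapping.keys q"
    using keys_mult[of p q] by blast
  then show "r + s \<le> (\<Sum>e\<in>S. Poly_Mapping.lookup \<mu> e)"
    using assms by (simp add: degree_at_least_def lookup_add sum.distrib add_mono)
qed

lemma degree_at_least_\<alpha>:
  assumes "finite S" "e \<in> S"
  shows "degree_at_least S 1 (\<alpha> e)"
  using assms by (simp add: degree_at_least_def \<alpha>_def lookup_single when_def)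

lemma degree_at_least_prod_\<alpha>:
  assumes "finite S" "finite X"
  shows "degree_at_least S (card (S \<inter> X)) (\<Prod>e\<in>X. \<alpha> e)"
  using assms(2)
proof (induction X rule: finite_induct)
  case (insert e X)
  show ?case
  proof (cases "e \<in> S")
    case True
    then have "card (S \<inter> insert e X) = 1 + card (S \<inter> X)"
      using insert.hyps assms(1) by simp
    then show ?thesis
      using degree_at_least_mult[OF degree_at_least_\<alpha>[OF assms(1) True] insert.IH] insert.hyps
      by simp
  next
    case False
    then show ?thesis
      using degree_at_least_mult[OF degree_at_least_0 insert.IH, of "\<alpha> e"] insert.hyps by simp
  qed
qed simp

text \<open>Only forests of nonzero weight matter, which is what lets momentum conservation raise
  the degree of the infrared remainder.\<close>

lemma degree_at_least_forest_sum:
  assumes "finite S" "finite X"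
    and "\<And>T. T \<in> \<F> \<Longrightarrow> w T \<noteq> 0 \<Longrightarrow> r \<le> card (S \<inter> (X - T))"
  shows "degree_at_least S r (forest_sum w X \<F>)"
  unfolding forest_sum_def
proof (rule degree_at_least_sum)
  fix T assume T: "T \<in> \<F>"
  show "degree_at_least S r (const (w T) * (\<Prod>e\<in>X - T. \<alpha> e))"
  proof (cases "w T = 0")
    case True
    then show ?thesis by (simp add: degree_at_least_def)
  next
    case False
    have "degree_at_least S (0 + card (S \<inter> (X - T))) (const (w T) * (\<Prod>e\<in>X - T. \<alpha> e))"
      using assms(1,2) by (intro degree_at_least_mult degree_at_least_prod_\<alpha>) simp_all
    then show ?thesis using assms(3)[OF T False] by (auto intro: degree_at_least_mono)
  qed
qed

lemma forest_sum_split: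
  assumes "finite \<F>"
  shows "forest_sum w X \<F> = forest_sum w X {T \<in> \<F>. P T} + forest_sum w X {T \<in> \<F>. \<not> P T}"
proof -
  have "{T \<in> \<F>. P T} \<union> {T \<in> \<F>. \<not> P T} = \<F>" "{T \<in> \<F>. P T} \<inter> {T \<in> \<F>. \<not> P T} = {}" by auto
  then show ?thesis
    unfolding forest_sum_def using assms by (metis (no_types, lifting) finite_Un sum.union_disjoint)
qed

section \<open>Component numbers and edge counts of forests\<close>

lemma joined_subset_if_joined_verts_subset:
  assumes "well_formed G" "S \<subseteq> edges G" "joined_verts G S \<subseteq> joined_verts G T"
  shows "joined G S \<subseteq> joined G T"
proof (rule joined_subset)
  fix e assume "e \<in> S"
  then have "(tail G e, head G e) \<in> joined_verts G S"
    using assms(1,2) joined_edge by (auto simp: joined_verts_def well_formed_def)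
  then have "(tail G e, head G e) \<in> joined_verts G T" using assms(3) by blast
  then show "(tail G e, head G e) \<in> joined G T" by (simp add: joined_verts_def)
qed

lemma joined_eq_if_ncomp_eq:
  assumes "well_formed G" "S \<subseteq> S'" "S' \<subseteq> edges G" "ncomp G S = ncomp G S'"
  shows "joined G S = joined G S'"
proof
  show "joined G S \<subseteq> joined G S'" by (rule joined_mono[OF assms(2)])
  have "joined_verts G S' = joined_verts G S"
    using assms by (intro ncomp_antimono(2)) (simp_all add: well_formed_def)
  then show "joined G S' \<subseteq> joined G S"
    using joined_subset_if_joined_verts_subset[OF assms(1,3)] by simp
qed

lemma joined_absorb:
  assumes "joined G S \<subseteq> joined G T"
  shows "joined G (S \<union> T) = joined G T"
proof
  show "joined G (S \<union> T) \<subseteq> joined G T"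
    using assms by (intro joined_subset) (auto intro: joined_edge)
  show "joined G T \<subseteq> joined G (S \<union> T)" by (rule joined_mono) simp
qed

lemma ncomp_cong: "joined G S = joined G T \<Longrightarrow> ncomp G S = ncomp G T"
  by (simp add: ncomp_quotient joined_verts_def)

lemma ncomp_insert_le:
  assumes "well_formed G" "e \<in> edges G"
  shows "ncomp G S \<le> Suc (ncomp G (insert e S))"
  using ncomp_insert_joined[of G e S] ncomp_insert_not_joined[of G e S] assms
  by (cases "(tail G e, head G e) \<in> joined G S") (auto simp: well_formed_def)

lemma ncomp_le_add_card:
  assumes "well_formed G" "finite U" "U \<subseteq> edges G"
  shows "ncomp G S \<le> ncomp G (S \<union> U) + card U"
  using assms(2,3)
proof (induction U rule: finite_induct)
  case (insert e U)
  then show ?case using ncomp_insert_le[OF assms(1), of e "S \<union> U"] by simp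
qed simp

text \<open>A subset of a forest is a forest. Adding the edges of \<open>T - S\<close> lowers the
  component number by at most one each, which gives one inequality; Euler's formula for
  \<open>S\<close> gives the other.\<close>

lemma card_forest_subset:
  assumes "well_formed G" "T \<in> spanning_trees k G" "S \<subseteq> T"
  shows "card S + ncomp G S = card (verts G)"
proof -
  have T: "T \<subseteq> edges G" "card T + k = card (verts G)" "ncomp G T = k"
    using assms(2) by (simp_all add: spanning_trees_iff[OF assms(1)])
  have fin: "finite T" using T(1) assms(1) finite_subset by (auto simp: well_formed_def)
  have "S \<union> (T - S) = T" using assms(3) by auto
  then have "ncomp G S \<le> k + card (T - S)"
    using ncomp_le_add_card[OF assms(1), of "T - S" S] fin T by auto
  moreover have "card T = card S + card (T - S)"
    using card_Diff_subset[of S T] card_mono[OF fin assms(3)] finite_subset[OF assms(3) fin] assms(3)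
    by simp
  ultimately have "card S + ncomp G S \<le> card (verts G)" using T by simp
  moreover have "card (verts G) \<le> card S + ncomp G S"
    using euler_formula[OF assms(1), of S] assms(3) T(1) by (metis dual_order.trans le_add2)
  ultimately show ?thesis by simp
qed

section \<open>Edge-subgraphs and quotients in terms of the ambient graph\<close>

lemma subgraph_simps [simp]:
  "verts (subgraph G \<gamma>) = tail G ` \<gamma> \<union> head G ` \<gamma>" "edges (subgraph G \<gamma>) = \<gamma>"
  "tail (subgraph G \<gamma>) = tail G" "head (subgraph G \<gamma>) = head G"
  "leg_at (subgraph G \<gamma>) = leg_at G" "momentum (subgraph G \<gamma>) = momentum G"
  by (simp_all add: subgraph_def bare_subgraph_def)

lemma quotient_graph_simps [simp]:
  "verts (quotient_graph G \<gamma>) = contract G \<gamma> ` verts G"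
  "edges (quotient_graph G \<gamma>) = edges G - \<gamma>"
  "tail (quotient_graph G \<gamma>) e = contract G \<gamma> (tail G e)"
  "head (quotient_graph G \<gamma>) e = contract G \<gamma> (head G e)"
  "legs (quotient_graph G \<gamma>) = legs G" "leg_at (quotient_graph G \<gamma>) i = contract G \<gamma> (leg_at G i)"
  "mass (quotient_graph G \<gamma>) = mass G" "momentum (quotient_graph G \<gamma>) = momentum G"
  by (simp_all add: quotient_graph_def)

lemma joined_subgraph: "joined (subgraph G \<gamma>) T = joined G T"
  by (simp add: joined_def adj_def)

lemma well_formed_subgraph: "well_formed G \<Longrightarrow> \<gamma> \<subseteq> edges G \<Longrightarrow> well_formed (subgraph G \<gamma>)"
  using finite_subset by (auto simp: well_formed_def)

text \<open>At a vertex that is not an endpoint of an edge of \<gamma>, the boundary vanishes for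
  every chain on \<open>T\<close>, so dropping these vertices leaves the cycle space
  unchanged.\<close>

lemma loop_number_subgraph:
  assumes "well_formed G" "\<gamma> \<subseteq> edges G" "T \<subseteq> \<gamma>"
  shows "loop_number (subgraph G \<gamma>\<lparr>edges := T\<rparr>) = loop_number (G\<lparr>edges := T\<rparr>)"
proof -
  have same: "boundary (subgraph G \<gamma>\<lparr>edges := T\<rparr>) c v = boundary (G\<lparr>edges := T\<rparr>) c v" for c v
    by (simp add: boundary_def)
  have out: "boundary (G\<lparr>edges := T\<rparr>) c v = 0" if "v \<notin> verts (subgraph G \<gamma>)" for c v
  proof -
    have "head G e \<noteq> v" "tail G e \<noteq> v" if "e \<in> T" for e
      using \<open>v \<notin> _\<close> that assms(3) by auto
    then show ?thesis by (simp add: boundary_def)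
  qed
  have "verts (subgraph G \<gamma>) \<subseteq> verts G" using assms(1,2) by (auto simp: well_formed_def)
  then have "(\<forall>v\<in>verts (subgraph G \<gamma>). boundary (G\<lparr>edges := T\<rparr>) c v = 0) \<longleftrightarrow>
      (\<forall>v\<in>verts G. boundary (G\<lparr>edges := T\<rparr>) c v = 0)" for c
    using out by blast
  then show ?thesis by (simp add: loop_number_def cycle_space_def same)
qed

text \<open>The component numbers differ by the vertices of \<open>G\<close> missing from \<gamma>,
  each of which is isolated. The proof compares Euler's formula in both graphs.\<close>

lemma ncomp_subgraph:
  assumes "well_formed G" "\<gamma> \<subseteq> edges G" "T \<subseteq> \<gamma>"
  shows "ncomp (subgraph G \<gamma>) T + card (verts G) = ncomp G T + card (verts (subgraph G \<gamma>))"
proof -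
  have "T \<subseteq> edges G" using assms(2,3) by blast
  then show ?thesis
    using euler_formula[OF well_formed_subgraph[OF assms(1,2)], of T] assms(3)
      euler_formula[OF assms(1), of T] loop_number_subgraph[OF assms]
    by (simp del: subgraph_simps(1))
qed

lemma loop_number_subgraph_eq:
  assumes "well_formed G" "\<gamma> \<subseteq> edges G"
  shows "loop_number (subgraph G \<gamma>) + card (verts G) = card \<gamma> + ncomp G \<gamma>"
proof -
  have same: "subgraph G \<gamma>\<lparr>edges := \<gamma>\<rparr> = subgraph G \<gamma>"
    by (simp add: subgraph_def bare_subgraph_def)
  show ?thesis
    using loop_number_subgraph[OF assms order_refl] euler_formula[OF assms] unfolding same by simp
qed

text \<open>Measuring the number of trees by its excess \<open>j\<close> over the number of
  components cancels the shift caused by the vertices missing from \<gamma>.\<close>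

lemma spanning_trees_subgraph:
  assumes "well_formed G" "\<gamma> \<subseteq> edges G"
  shows "T \<in> spanning_trees (card (components (subgraph G \<gamma>)) + j) (subgraph G \<gamma>) \<longleftrightarrow>
    T \<subseteq> \<gamma> \<and> card T + (ncomp G \<gamma> + j) = card (verts G) \<and> ncomp G T = ncomp G \<gamma> + j"
  using ncomp_subgraph[OF assms order_refl] ncomp_subgraph[OF assms, of T]
    ncomp_edges[of "subgraph G \<gamma>"]
  unfolding spanning_trees_iff[OF well_formed_subgraph[OF assms]] subgraph_simps(2) by auto

text \<open>A nontrivial path in \<gamma> has both ends in \<gamma> and so lies in one of its
  components. For the other vertices, the singleton in \<open>contract\<close> is the whole
  class.\<close>

lemma contract_eq: "contract G \<gamma> v = joined G \<gamma> `` {v}"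
proof -
  let ?V = "verts (subgraph G \<gamma>)" and ?R = "joined_verts (subgraph G \<gamma>) \<gamma>"
  have K: "components (subgraph G \<gamma>) = ?V // ?R"
    using components_quotient[of "subgraph G \<gamma>"] by (simp del: subgraph_simps(1))
  show ?thesis
  proof (intro equalityI subsetI)
    fix w assume "w \<in> contract G \<gamma> v"
    then consider "w = v" | C where "C \<in> ?V // ?R" "v \<in> C" "w \<in> C"
      unfolding contract_def K by blast
    then show "w \<in> joined G \<gamma> `` {v}"
    proof cases
      case 2
      have "(v, w) \<in> ?R"
        by (rule in_quotient_imp_in_rel[OF equiv_joined_verts 2(1)]) (use 2 in blast)
      then show ?thesis by (simp add: joined_verts_def joined_subgraph)
    qed simp
  next
    fix w assume "w \<in> joined G \<gamma> `` {v}"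
    then have vw: "(v, w) \<in> joined G \<gamma>" by simp
    then have "w = v \<or> v \<in> ?V \<and> w \<in> ?V"
      by (induction rule: joined_induct) auto
    then show "w \<in> contract G \<gamma> v"
    proof
      assume "v \<in> ?V \<and> w \<in> ?V"
      then have "v \<in> ?V" "(v, v) \<in> ?R" "(v, w) \<in> ?R"
        using vw by (simp_all add: joined_verts_def joined_subgraph)
      then have "?R `` {v} \<in> components (subgraph G \<gamma>)" "v \<in> ?R `` {v}" "w \<in> ?R `` {v}"
        unfolding K by (blast intro: quotientI)+
      then show ?thesis unfolding contract_def by blast
    qed (simp add: contract_def)
  qed
qed

lemma contract_eq_iff: "contract G \<gamma> v = contract G \<gamma> w \<longleftrightarrow> (v, w) \<in> joined G \<gamma>"
  unfolding contract_eq using joined_refl joined_sym joined_trans by fast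

text \<open>A step between representatives of the same vertex of the quotient is a path in \<gamma>,
  so paths in the quotient lift to paths in \<open>G\<close> that may use \<gamma>, and such paths
  project back.\<close>

lemma joined_quotient_graph:
  "(contract G \<gamma> v, contract G \<gamma> w) \<in> joined (quotient_graph G \<gamma>) T \<longleftrightarrow>
    (v, w) \<in> joined G (\<gamma> \<union> T)"
proof
  have \<gamma>: "joined G \<gamma> \<subseteq> joined G (\<gamma> \<union> T)" by (rule joined_mono) simp
  assume "(contract G \<gamma> v, contract G \<gamma> w) \<in> joined (quotient_graph G \<gamma>) T"
  \<comment> \<open>The claim is made for all representatives of the end vertex, since an edge of
    the quotient may start at a different one from that reached so far.\<close>
  then have "\<forall>u. contract G \<gamma> w = contract G \<gamma> u \<longrightarrow> (v, u) \<in> joined G (\<gamma> \<union> T)"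
  proof (induction rule: joined_induct)
    case base
    then show ?case using \<gamma> by (auto simp: contract_eq_iff)
  next
    case (edge x y e)
    have e: "(tail G e, head G e) \<in> joined G (\<gamma> \<union> T)" using edge(2) by (simp add: joined_edge)
    from edge(3) obtain a b where ab: "x = contract G \<gamma> a" "y = contract G \<gamma> b"
      "(a, b) \<in> joined G (\<gamma> \<union> T)"
      using e joined_sym[OF e] by auto
    show ?case
    proof (intro allI impI)
      fix u assume "y = contract G \<gamma> u"
      then have "(b, u) \<in> joined G (\<gamma> \<union> T)" using ab(2) \<gamma> by (auto simp: contract_eq_iff)
      moreover have "(v, a) \<in> joined G (\<gamma> \<union> T)" using edge(4) ab(1) by simp
      ultimately show "(v, u) \<in> joined G (\<gamma> \<union> T)" using ab(3) joined_trans by metis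
    qed
  qed
  then show "(v, w) \<in> joined G (\<gamma> \<union> T)" by simp
next
  assume "(v, w) \<in> joined G (\<gamma> \<union> T)"
  then show "(contract G \<gamma> v, contract G \<gamma> w) \<in> joined (quotient_graph G \<gamma>) T"
  proof (induction rule: joined_induct)
    case (edge x y e)
    have "(contract G \<gamma> x, contract G \<gamma> y) \<in> joined (quotient_graph G \<gamma>) T"
    proof (cases "e \<in> \<gamma>")
      case True
      then have "(x, y) \<in> joined G \<gamma>" using edge(3) joined_edge[of e \<gamma> G] joined_sym by auto
      then show ?thesis by (metis contract_eq_iff joined_refl)
    next
      case False
      then have "(contract G \<gamma> (tail G e), contract G \<gamma> (head G e)) \<in> joined (quotient_graph G \<gamma>) T"
        using edge(2) joined_edge[of e T "quotient_graph G \<gamma>"] by simp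
      then show ?thesis using edge(3) joined_sym by auto
    qed
    then show ?case using edge(4) joined_trans by metis
  qed simp
qed

lemma ncomp_quotient_graph: "ncomp (quotient_graph G \<gamma>) T = ncomp G (\<gamma> \<union> T)"
  unfolding ncomp_quotient
proof (rule card_quotient_surj[OF equiv_joined_verts equiv_joined_verts])
  show "contract G \<gamma> ` verts G = verts (quotient_graph G \<gamma>)" by simp
  fix u v assume "u \<in> verts G" "v \<in> verts G"
  then have "contract G \<gamma> u \<in> verts (quotient_graph G \<gamma>)"
    "contract G \<gamma> v \<in> verts (quotient_graph G \<gamma>)" by simp_all
  then show "(contract G \<gamma> u, contract G \<gamma> v) \<in> joined_verts (quotient_graph G \<gamma>) T \<longleftrightarrow>
      (u, v) \<in> joined_verts G (\<gamma> \<union> T)"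
    using \<open>u \<in> verts G\<close> \<open>v \<in> verts G\<close>
    unfolding joined_verts_def by (simp del: quotient_graph_simps add: joined_quotient_graph)
qed

lemma well_formed_quotient_graph: "well_formed G \<Longrightarrow> well_formed (quotient_graph G \<gamma>)"
  by (auto simp: well_formed_def)

lemma card_verts_quotient_graph: "card (verts (quotient_graph G \<gamma>)) = ncomp G \<gamma>"
  using ncomp_empty[of "quotient_graph G \<gamma>"] ncomp_quotient_graph[of G \<gamma> "{}"] by simp

lemma spanning_trees_quotient_graph:
  assumes "well_formed G"
  shows "T \<in> spanning_trees k (quotient_graph G \<gamma>) \<longleftrightarrow>
    T \<subseteq> edges G - \<gamma> \<and> card T + k = ncomp G \<gamma> \<and> ncomp G (\<gamma> \<union> T) = k"
  unfolding spanning_trees_iff[OF well_formed_quotient_graph[OF assms]]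
    card_verts_quotient_graph ncomp_quotient_graph by simp

section \<open>Factorization\<close>

lemma forest_sum_contract:
  assumes "well_formed G" "\<gamma> \<subseteq> edges G" "\<F> \<subseteq> Pow (edges G)"
    and "\<And>T. T \<subseteq> edges G \<Longrightarrow> T \<in> \<F> \<longleftrightarrow>
      T \<inter> \<gamma> \<in> spanning_trees j (subgraph G \<gamma>) \<and> T - \<gamma> \<in> spanning_trees k (quotient_graph G \<gamma>)"
    and "\<And>T. T \<in> \<F> \<Longrightarrow> w T = u (T \<inter> \<gamma>) * v (T - \<gamma>)"
  shows "forest_sum w (edges G) \<F> =
    forest_sum u \<gamma> (spanning_trees j (subgraph G \<gamma>)) *
    forest_sum v (edges G - \<gamma>) (spanning_trees k (quotient_graph G \<gamma>))"
proof -
  have fin: "finite \<gamma>" "finite (edges G - \<gamma>)"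
    using assms(1,2) finite_subset by (auto simp: well_formed_def)
  have E: "\<gamma> \<union> (edges G - \<gamma>) = edges G" using assms(2) by auto
  have diff: "T \<inter> (edges G - \<gamma>) = T - \<gamma>" if "T \<subseteq> edges G" for T using that by auto
  have "forest_sum w (\<gamma> \<union> (edges G - \<gamma>)) \<F> =
    forest_sum u \<gamma> (spanning_trees j (subgraph G \<gamma>)) *
    forest_sum v (edges G - \<gamma>) (spanning_trees k (quotient_graph G \<gamma>))"
  proof (rule forest_sum_union[OF fin Diff_disjoint])
    show "\<F> \<subseteq> Pow (\<gamma> \<union> (edges G - \<gamma>))" using assms(3) E by simp
    show "spanning_trees j (subgraph G \<gamma>) \<subseteq> Pow \<gamma>"
      "spanning_trees k (quotient_graph G \<gamma>) \<subseteq> Pow (edges G - \<gamma>)"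
      by (auto simp: spanning_trees_def)
    show "T \<in> \<F> \<longleftrightarrow> T \<inter> \<gamma> \<in> spanning_trees j (subgraph G \<gamma>) \<and>
        T \<inter> (edges G - \<gamma>) \<in> spanning_trees k (quotient_graph G \<gamma>)"
      if "T \<subseteq> \<gamma> \<union> (edges G - \<gamma>)" for T
      using assms(4)[of T] that diff[of T] E by simp
    show "w T = u (T \<inter> \<gamma>) * v (T \<inter> (edges G - \<gamma>))" if "T \<in> \<F>" for T
      using assms(5)[OF that] assms(3) that diff[of T] by auto
  qed
  then show ?thesis unfolding E .
qed

lemma card_Int_Diff:
  assumes "finite T"
  shows "card T = card (T \<inter> \<gamma>) + card (T - \<gamma>)"
  using card_Un_disjoint[of "T \<inter> \<gamma>" "T - \<gamma>"] assms by (simp add: Int_Diff_Un Int_Diff_disjoint)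

text \<open>Here \<open>T \<inter> \<gamma>\<close> already joins everything that \<gamma> joins, so
  adding the rest of \<gamma> to \<open>T\<close> joins nothing new.\<close>

lemma joined_Un_if_ncomp_eq:
  assumes "well_formed G" "\<gamma> \<subseteq> edges G" "ncomp G (T \<inter> \<gamma>) = ncomp G \<gamma>"
  shows "joined G (\<gamma> \<union> T) = joined G T"
proof -
  have "joined G (T \<inter> \<gamma>) = joined G \<gamma>"
    using joined_eq_if_ncomp_eq[OF assms(1) Int_lower2 assms(2,3)] .
  then show ?thesis using joined_mono[of "T \<inter> \<gamma>" T G] joined_absorb[of G \<gamma> T] by simp
qed

text \<open>If \<open>T \<inter> \<gamma>\<close> is a maximal forest of \<gamma>, then
  \<open>T\<close> and \<open>\<gamma> \<union> T\<close> have the same number of components. The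
  rest is arithmetic: the edge counts of \<open>T \<inter> \<gamma>\<close> and
  \<open>T - \<gamma>\<close> add up to that of \<open>T\<close>.\<close>

lemma spanning_trees_UV:
  assumes "well_formed G" "\<gamma> \<subseteq> edges G" "T \<subseteq> edges G"
  shows "T \<in> spanning_trees k G \<and> ncomp G (T \<inter> \<gamma>) = ncomp G \<gamma> \<longleftrightarrow>
    T \<inter> \<gamma> \<in> spanning_trees (card (components (subgraph G \<gamma>))) (subgraph G \<gamma>) \<and>
    T - \<gamma> \<in> spanning_trees k (quotient_graph G \<gamma>)"
proof -
  have fin: "finite T" using assms(1,3) finite_subset by (auto simp: well_formed_def)
  have sub: "T \<inter> \<gamma> \<in> spanning_trees (card (components (subgraph G \<gamma>))) (subgraph G \<gamma>) \<longleftrightarrow>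
      card (T \<inter> \<gamma>) + ncomp G \<gamma> = card (verts G) \<and> ncomp G (T \<inter> \<gamma>) = ncomp G \<gamma>"
    using spanning_trees_subgraph[OF assms(1,2), of "T \<inter> \<gamma>" 0] by simp
  have quot: "T - \<gamma> \<in> spanning_trees k (quotient_graph G \<gamma>) \<longleftrightarrow>
      card (T - \<gamma>) + k = ncomp G \<gamma> \<and> ncomp G (\<gamma> \<union> T) = k"
    using spanning_trees_quotient_graph[OF assms(1), of "T - \<gamma>" k \<gamma>] assms(3) by auto
  have "ncomp G (\<gamma> \<union> T) = ncomp G T" if "ncomp G (T \<inter> \<gamma>) = ncomp G \<gamma>"
    using joined_Un_if_ncomp_eq[OF assms(1,2) that] by (rule ncomp_cong)
  then show ?thesis
    unfolding sub quot spanning_trees_iff[OF assms(1)]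
    using card_forest_subset[OF assms(1), of T k "T \<inter> \<gamma>"] card_Int_Diff[OF fin, of \<gamma>] assms(3)
    unfolding spanning_trees_iff[OF assms(1)] by auto
qed

text \<open>One suitable edge \<open>e\<close> of \<gamma> brings \<open>T \<inter> \<gamma>\<close>
  to the component number of \<gamma>. Then \<open>insert e T\<close> has as many components as
  \<open>\<gamma> \<union> T\<close>, and a single edge merges at most two components.\<close>

lemma ncomp_merge_le:
  assumes "well_formed G" "\<gamma> \<subseteq> edges G" "ncomp G (T \<inter> \<gamma>) = Suc (ncomp G \<gamma>)"
  shows "ncomp G T \<le> Suc (ncomp G (\<gamma> \<union> T))"
proof -
  have "\<exists>e\<in>\<gamma>. (tail G e, head G e) \<notin> joined G (T \<inter> \<gamma>)"
  proof (rule ccontr)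
    assume "\<not> ?thesis"
    then have "joined G \<gamma> \<subseteq> joined G (T \<inter> \<gamma>)" by (intro joined_subset) auto
    moreover have "joined G (T \<inter> \<gamma>) \<subseteq> joined G \<gamma>" by (rule joined_mono) simp
    ultimately show False using assms(3) ncomp_cong[of G \<gamma> "T \<inter> \<gamma>"] by simp
  qed
  then obtain e where e: "e \<in> \<gamma>" "(tail G e, head G e) \<notin> joined G (T \<inter> \<gamma>)" by blast
  have "Suc (ncomp G (insert e (T \<inter> \<gamma>))) = ncomp G (T \<inter> \<gamma>)"
    using assms(1,2) e by (intro ncomp_insert_not_joined) (auto simp: well_formed_def)
  moreover have "insert e (T \<inter> \<gamma>) = insert e T \<inter> \<gamma>" using e(1) by auto
  ultimately have "ncomp G (insert e T \<inter> \<gamma>) = ncomp G \<gamma>" using assms(3) by simp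
  then have "ncomp G (\<gamma> \<union> insert e T) = ncomp G (insert e T)"
    using ncomp_cong[OF joined_Un_if_ncomp_eq[OF assms(1,2)]] by blast
  moreover have "\<gamma> \<union> insert e T = \<gamma> \<union> T" using e(1) by auto
  ultimately show ?thesis using ncomp_insert_le[OF assms(1), of e T] e(1) assms(2) by auto
qed

text \<open>From right to left, the edge counts give \<open>T\<close> two edges fewer than there are
  vertices. Euler's formula then yields at least 2 components, and \<open>ncomp_merge_le\<close> at
  most 2.\<close>

lemma spanning_trees_IR:
  assumes "well_formed G" "\<gamma> \<subseteq> edges G" "T \<subseteq> edges G"
  shows "T \<in> spanning_trees 2 G \<and> ncomp G (T \<inter> \<gamma>) = Suc (ncomp G \<gamma>) \<and> ncomp G (\<gamma> \<union> T) = 1 \<longleftrightarrow>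
    T \<inter> \<gamma> \<in> spanning_trees (card (components (subgraph G \<gamma>)) + 1) (subgraph G \<gamma>) \<and>
    T - \<gamma> \<in> spanning_trees 1 (quotient_graph G \<gamma>)"
proof -
  have fin: "finite T" using assms(1,3) finite_subset by (auto simp: well_formed_def)
  have sub: "T \<inter> \<gamma> \<in> spanning_trees (card (components (subgraph G \<gamma>)) + 1) (subgraph G \<gamma>) \<longleftrightarrow>
      card (T \<inter> \<gamma>) + (ncomp G \<gamma> + 1) = card (verts G) \<and> ncomp G (T \<inter> \<gamma>) = ncomp G \<gamma> + 1"
    using spanning_trees_subgraph[OF assms(1,2), of "T \<inter> \<gamma>" 1] by simp
  have quot: "T - \<gamma> \<in> spanning_trees 1 (quotient_graph G \<gamma>) \<longleftrightarrow>
      card (T - \<gamma>) + 1 = ncomp G \<gamma> \<and> ncomp G (\<gamma> \<union> T) = 1"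
    using spanning_trees_quotient_graph[OF assms(1), of "T - \<gamma>" 1 \<gamma>] assms(3) by auto
  have "ncomp G T \<le> Suc (ncomp G (\<gamma> \<union> T))" if "ncomp G (T \<inter> \<gamma>) = Suc (ncomp G \<gamma>)"
    using ncomp_merge_le[OF assms(1,2) that] .
  moreover have "card (verts G) \<le> card T + ncomp G T"
    using euler_formula[OF assms(1,3)] by simp
  ultimately show ?thesis
    unfolding sub quot spanning_trees_iff[OF assms(1)]
    using card_forest_subset[OF assms(1), of T 2 "T \<inter> \<gamma>"] card_Int_Diff[OF fin, of \<gamma>] assms(3)
    unfolding spanning_trees_iff[OF assms(1)] by auto
qed

text \<open>The cardinality on the left is the degree of the monomial of \<open>T\<close> in the
  variables of \<gamma>. The equation combines Euler's formula for \<gamma> with the edge count of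
  the forest \<open>T \<inter> \<gamma>\<close>.\<close>

lemma card_Int_complement_forest:
  assumes "well_formed G" "\<gamma> \<subseteq> edges G" "T \<in> spanning_trees k G"
  shows "card (\<gamma> \<inter> (edges G - T)) + ncomp G \<gamma> = loop_number (subgraph G \<gamma>) + ncomp G (T \<inter> \<gamma>)"
proof -
  have "finite \<gamma>" using assms(1,2) finite_subset by (auto simp: well_formed_def)
  moreover have "\<gamma> \<inter> (edges G - T) = \<gamma> - T" using assms(2) by auto
  ultimately have "card \<gamma> = card (T \<inter> \<gamma>) + card (\<gamma> \<inter> (edges G - T))"
    using card_Int_Diff[of \<gamma> T] by (simp add: Int_commute)
  then show ?thesis
    using loop_number_subgraph_eq[OF assms(1,2)] card_forest_subset[OF assms(1,3), of "T \<inter> \<gamma>"]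
    by simp
qed

text \<open>This covers \<Psi> with constant weight and \<Phi> with the momentum weight. Only on
  leading forests must the weight be determined by the part outside \<gamma>.\<close>

lemma forest_sum_UV:
  assumes "well_formed G" "\<gamma> \<subseteq> edges G"
    and "\<And>T. T \<subseteq> edges G \<Longrightarrow> ncomp G (T \<inter> \<gamma>) = ncomp G \<gamma> \<Longrightarrow> w T = u (T - \<gamma>)"
  shows "\<exists>R. forest_sum w (edges G) (spanning_trees k G) =
      \<Psi> (subgraph G \<gamma>) * forest_sum u (edges G - \<gamma>) (spanning_trees k (quotient_graph G \<gamma>)) + R \<and>
    degree_at_least \<gamma> (Suc (loop_number (subgraph G \<gamma>))) R"
proof -
  let ?F = "spanning_trees k G" and ?P = "\<lambda>T. ncomp G (T \<inter> \<gamma>) = ncomp G \<gamma>"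
  have fin: "finite \<gamma>" "finite (edges G)" "finite (verts G)"
    using assms(1,2) finite_subset by (auto simp: well_formed_def)
  have sub: "T \<subseteq> edges G" if "T \<in> ?F" for T using that by (simp add: spanning_trees_def)
  have "forest_sum w (edges G) {T \<in> ?F. ?P T} =
      forest_sum (\<lambda>_. 1) \<gamma> (spanning_trees (card (components (subgraph G \<gamma>))) (subgraph G \<gamma>)) *
      forest_sum u (edges G - \<gamma>) (spanning_trees k (quotient_graph G \<gamma>))"
  proof (rule forest_sum_contract[OF assms(1,2)])
    show "{T \<in> ?F. ?P T} \<subseteq> Pow (edges G)" using sub by auto
    show "T \<in> {T \<in> ?F. ?P T} \<longleftrightarrow>
        T \<inter> \<gamma> \<in> spanning_trees (card (components (subgraph G \<gamma>))) (subgraph G \<gamma>) \<and>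
        T - \<gamma> \<in> spanning_trees k (quotient_graph G \<gamma>)" if "T \<subseteq> edges G" for T
      using spanning_trees_UV[OF assms(1,2) that] by simp
    show "w T = 1 * u (T - \<gamma>)" if "T \<in> {T \<in> ?F. ?P T}" for T
      using assms(3)[of T] sub that by simp
  qed
  also have "forest_sum (\<lambda>_. 1) \<gamma> (spanning_trees (card (components (subgraph G \<gamma>))) (subgraph G \<gamma>)) =
      \<Psi> (subgraph G \<gamma>)"
    using \<Psi>_forest_sum[OF well_formed_subgraph[OF assms(1,2)]] by simp
  finally have main: "forest_sum w (edges G) {T \<in> ?F. ?P T} =
      \<Psi> (subgraph G \<gamma>) * forest_sum u (edges G - \<gamma>) (spanning_trees k (quotient_graph G \<gamma>))" .
  have "degree_at_least \<gamma> (Suc (loop_number (subgraph G \<gamma>)))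
      (forest_sum w (edges G) {T \<in> ?F. \<not> ?P T})"
  proof (rule degree_at_least_forest_sum[OF fin(1,2)])
    fix T assume T: "T \<in> {T \<in> ?F. \<not> ?P T}"
    \<comment> \<open>For a forest that is not leading this inequality is strict, which raises the
      degree by at least one.\<close>
    have "ncomp G \<gamma> \<le> ncomp G (T \<inter> \<gamma>)" by (rule ncomp_antimono(1)[OF fin(3)]) simp
    then show "Suc (loop_number (subgraph G \<gamma>)) \<le> card (\<gamma> \<inter> (edges G - T))"
      using card_Int_complement_forest[OF assms(1,2), of T k] T by simp
  qed
  then show ?thesis
    using forest_sum_split[OF finite_spanning_trees[OF fin(2)], of w "edges G" k ?P] main by auto
qed

lemma momentum_weight_quotient_graph:
  assumes "well_formed G" "\<gamma> \<subseteq> edges G" "ncomp G (T \<inter> \<gamma>) = ncomp G \<gamma>"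
  shows "momentum_weight G T = momentum_weight (quotient_graph G \<gamma>) (T - \<gamma>)"
  unfolding momentum_weight_def
  by (simp add: joined_quotient_graph joined_Un_if_ncomp_eq[OF assms])

text \<open>Intersecting the relations of \<open>T\<close> and \<gamma> gives one between those of
  \<open>T \<inter> \<gamma>\<close> and \<gamma>, whose class numbers differ by one. It must
  therefore equal one of them. It is not that of \<gamma>, since then adding \<gamma> to
  \<open>T\<close> would join nothing. Consequently \<open>T\<close> and
  \<open>T \<inter> \<gamma>\<close> separate the legs alike.\<close>

lemma joined_separating_forest:
  assumes "well_formed G" "\<gamma> \<subseteq> edges G"
    and "ncomp G (T \<inter> \<gamma>) = Suc (ncomp G \<gamma>)" "ncomp G (\<gamma> \<union> T) \<noteq> ncomp G T"
    and "u \<in> verts G" "v \<in> verts G" "(u, v) \<in> joined G \<gamma>"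
  shows "(u, v) \<in> joined G T \<longleftrightarrow> (u, v) \<in> joined G (T \<inter> \<gamma>)"
proof
  show "(u, v) \<in> joined G (T \<inter> \<gamma>) \<Longrightarrow> (u, v) \<in> joined G T"
    using joined_mono[of "T \<inter> \<gamma>" T G] by blast
  assume uv: "(u, v) \<in> joined G T"
  show "(u, v) \<in> joined G (T \<inter> \<gamma>)"
  proof (rule ccontr)
    assume not: "(u, v) \<notin> joined G (T \<inter> \<gamma>)"
    let ?R = "joined_verts G T \<inter> joined_verts G \<gamma>" and ?S = "joined_verts G (T \<inter> \<gamma>)"
    have fin: "finite (verts G)" using assms(1) by (simp add: well_formed_def)
    have eqv: "equiv (verts G) ?R"
      using equiv_joined_verts[of G T] equiv_joined_verts[of G \<gamma>]
      by (auto simp: equiv_def refl_on_def intro: sym_Int trans_Int)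
    have SR: "?S \<subseteq> ?R" by (simp add: joined_verts_mono)
    have "(u, v) \<in> ?R" "(u, v) \<notin> ?S" using uv not assms(5-7) by (auto simp: joined_verts_def)
    then have "?R \<noteq> ?S" by blast
    then have "card (verts G // ?R) < Suc (ncomp G \<gamma>)"
      using card_quotient_mono[OF fin equiv_joined_verts eqv SR] assms(3)
      by (auto simp: ncomp_quotient less_le)
    then have "card (verts G // joined_verts G \<gamma>) = card (verts G // ?R)"
      using card_quotient_mono(1)[OF fin eqv equiv_joined_verts Int_lower2]
      by (simp add: ncomp_quotient)
    then have "joined_verts G \<gamma> = ?R"
      by (rule card_quotient_mono(2)[OF fin eqv equiv_joined_verts Int_lower2])
    then have "joined_verts G \<gamma> \<subseteq> joined_verts G T" by blast
    then have "joined G \<gamma> \<subseteq> joined G T"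
      by (rule joined_subset_if_joined_verts_subset[OF assms(1,2)])
    then show False using ncomp_cong[OF joined_absorb] assms(4) by blast
  qed
qed

section \<open>Kinematics of quotients and of mass-momentum spanning subgraphs\<close>

lemma card_components_1:
  assumes "card (components G) = 1"
  shows "components G = {verts G}"
proof -
  obtain C where C: "components G = {C}" using assms card_1_singletonE by blast
  have "\<Union> (components G) = verts G"
    unfolding components_quotient by (rule Union_quotient[OF equiv_joined_verts])
  then show ?thesis using C by simp
qed

lemma feynman_graph_quotient_graph:
  assumes "feynman_graph G" "connected_graph G" "\<gamma> \<subseteq> edges G"
  shows "card (components (quotient_graph G \<gamma>)) = 1" "feynman_graph (quotient_graph G \<gamma>)"
proof -
  have "\<gamma> \<union> (edges G - \<gamma>) = edges G" using assms(3) by auto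
  then show one: "card (components (quotient_graph G \<gamma>)) = 1"
    using ncomp_quotient_graph[of G \<gamma> "edges G - \<gamma>"] ncomp_edges[of "quotient_graph G \<gamma>"] assms(2)
    by (simp add: ncomp_edges connected_graph_def)
  show "feynman_graph (quotient_graph G \<gamma>)"
    using assms(1) unfolding feynman_graph_def card_components_1[OF one] by auto
qed

lemma momentum_spanning_joined:
  assumes "momentum_spanning G \<gamma>" "i \<in> legs G" "j \<in> legs G"
  shows "(leg_at G i, leg_at G j) \<in> joined G \<gamma>"
proof -
  obtain C where C: "C \<in> components (bare_subgraph G \<gamma>)" "leg_at G i \<in> C" "leg_at G j \<in> C"
    using assms unfolding momentum_spanning_def by blast
  have "(leg_at G i, leg_at G j) \<in> joined_verts (bare_subgraph G \<gamma>) (edges (bare_subgraph G \<gamma>))"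
    by (rule in_quotient_imp_in_rel[OF equiv_joined_verts C(1)[unfolded components_quotient]])
      (use C in simp)
  then show ?thesis by (simp add: joined_verts_def joined_def adj_def bare_subgraph_def)
qed

lemma mass_momentum_spanning_subgraph:
  assumes "mass_momentum_spanning G \<gamma>"
  shows "legs (subgraph G \<gamma>) = legs G" "mass (subgraph G \<gamma>) = mass G"
  using assms by (simp_all add: subgraph_def)

lemma feynman_graph_subgraph:
  assumes "feynman_graph G" "\<gamma> \<subseteq> edges G" "mass_momentum_spanning G \<gamma>"
  shows "feynman_graph (subgraph G \<gamma>)"
proof -
  note legs = mass_momentum_spanning_subgraph(1)[OF assms(3)]
  have "components (subgraph G \<gamma>) = components (bare_subgraph G \<gamma>)"
    by (simp add: subgraph_def components_def adj_def)
  moreover have "verts (subgraph G \<gamma>) = verts (bare_subgraph G \<gamma>)" by (simp add: bare_subgraph_def)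
  moreover have "well_formed (subgraph G \<gamma>)"
    by (rule well_formed_subgraph[OF feynman_graph_well_formed[OF assms(1)] assms(2)])
  ultimately show ?thesis
    using assms(1,3)
    unfolding feynman_graph_def well_formed_def mass_momentum_spanning_def momentum_spanning_def legs
    by (simp del: subgraph_simps(1))
qed

text \<open>Leading forests split one component of \<gamma> in two while
  \<open>\<gamma> \<union> T\<close> stays connected. Any other forest either has weight 0 or leaves
  at least two extra components in \<gamma>.\<close>

lemma forest_sum_IR:
  assumes "feynman_graph G" "connected_graph G" "\<gamma> \<subseteq> edges G" "mass_momentum_spanning G \<gamma>"
  shows "\<exists>R. \<Phi> G = \<Phi> (subgraph G \<gamma>) * \<Psi> (quotient_graph G \<gamma>) + R \<and>
    degree_at_least \<gamma> (Suc (Suc (loop_number (subgraph G \<gamma>)))) R"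
proof -
  note wf = feynman_graph_well_formed[OF assms(1)]
  let ?F = "spanning_trees 2 G"
  let ?P = "\<lambda>T. ncomp G (T \<inter> \<gamma>) = Suc (ncomp G \<gamma>) \<and> ncomp G (\<gamma> \<union> T) = 1"
  have fin: "finite \<gamma>" "finite (edges G)" "finite (verts G)"
    using wf assms(3) finite_subset by (auto simp: well_formed_def)
  have sub: "T \<subseteq> edges G" "ncomp G T = 2" if "T \<in> ?F" for T
    using that by (simp_all add: spanning_trees_iff[OF wf])
  have legs: "leg_at G i \<in> verts G" if "i \<in> legs G" for i
    using assms(1) that by (simp add: feynman_graph_def)
  have joined: "(leg_at G i, leg_at G j) \<in> joined G \<gamma>" if "i \<in> legs G" "j \<in> legs G" for i j
    using assms(4) that by (intro momentum_spanning_joined) (simp_all add: mass_momentum_spanning_def)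
  have conn: "card (components G) = 1" using assms(2) by (simp add: connected_graph_def)
  have weight: "momentum_weight G T = momentum_weight (subgraph G \<gamma>) (T \<inter> \<gamma>)"
    if "T \<in> {T \<in> ?F. ?P T}" for T
  proof -
    have "(leg_at G i, leg_at G j) \<in> joined G T \<longleftrightarrow> (leg_at G i, leg_at G j) \<in> joined G (T \<inter> \<gamma>)"
      if "i \<in> legs G" "j \<in> legs G" for i j
      using joined_separating_forest[OF wf assms(3), of T "leg_at G i" "leg_at G j"] sub(2)[of T]
        \<open>T \<in> _\<close> legs joined that by simp
    then show ?thesis
      by (simp add: momentum_weight_def joined_subgraph mass_momentum_spanning_subgraph[OF assms(4)])
  qed
  have "forest_sum (momentum_weight G) (edges G) {T \<in> ?F. ?P T} =
      forest_sum (momentum_weight (subgraph G \<gamma>)) \<gamma>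
        (spanning_trees (card (components (subgraph G \<gamma>)) + 1) (subgraph G \<gamma>)) *
      forest_sum (\<lambda>_. 1) (edges G - \<gamma>) (spanning_trees 1 (quotient_graph G \<gamma>))"
  proof (rule forest_sum_contract[OF wf assms(3)])
    show "{T \<in> ?F. ?P T} \<subseteq> Pow (edges G)" using sub by auto
    show "T \<in> {T \<in> ?F. ?P T} \<longleftrightarrow>
        T \<inter> \<gamma> \<in> spanning_trees (card (components (subgraph G \<gamma>)) + 1) (subgraph G \<gamma>) \<and>
        T - \<gamma> \<in> spanning_trees 1 (quotient_graph G \<gamma>)" if "T \<subseteq> edges G" for T
      using spanning_trees_IR[OF wf assms(3) that] by simp
    show "momentum_weight G T = momentum_weight (subgraph G \<gamma>) (T \<inter> \<gamma>) * 1"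
      if "T \<in> {T \<in> ?F. ?P T}" for T using weight[OF that] by simp
  qed
  also have "\<dots> = \<Phi> (subgraph G \<gamma>) * \<Psi> (quotient_graph G \<gamma>)"
    using \<Phi>_forest_sum[OF feynman_graph_subgraph[OF assms(1,3,4)]]
      \<Psi>_forest_sum[OF well_formed_quotient_graph[OF wf], of \<gamma>]
      feynman_graph_quotient_graph(1)[OF assms(1-3)] by simp
  finally have main: "forest_sum (momentum_weight G) (edges G) {T \<in> ?F. ?P T} =
      \<Phi> (subgraph G \<gamma>) * \<Psi> (quotient_graph G \<gamma>)" .
  have "degree_at_least \<gamma> (Suc (Suc (loop_number (subgraph G \<gamma>))))
      (forest_sum (momentum_weight G) (edges G) {T \<in> ?F. \<not> ?P T})"
  proof (rule degree_at_least_forest_sum[OF fin(1,2)])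
    fix T assume T: "T \<in> {T \<in> ?F. \<not> ?P T}" "momentum_weight G T \<noteq> 0"
    then have TF: "T \<in> ?F" by simp
    have le: "ncomp G \<gamma> \<le> ncomp G (T \<inter> \<gamma>)" "ncomp G (\<gamma> \<union> T) \<le> ncomp G T"
      "ncomp G (edges G) \<le> ncomp G (\<gamma> \<union> T)"
      using sub(1)[OF TF] assms(3) by (auto intro!: ncomp_antimono(1)[OF fin(3)])
    \<comment> \<open>If \<gamma> joined nothing new, then \<open>T\<close> would already join all
      legs, and momentum conservation would make its weight 0.\<close>
    have Un: "joined G (\<gamma> \<union> T) \<noteq> joined G T"
    proof
      assume "joined G (\<gamma> \<union> T) = joined G T"
      then have "joined G \<gamma> \<subseteq> joined G T" using joined_mono[of \<gamma> "\<gamma> \<union> T" G] by simp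
      then have "momentum_weight G T = 0"
        using joined assms(1) by (intro momentum_weight_joined) (auto simp: feynman_graph_def)
      then show False using T(2) by simp
    qed
    then have "ncomp G (T \<inter> \<gamma>) \<noteq> ncomp G \<gamma>" using joined_Un_if_ncomp_eq[OF wf assms(3)] by blast
    moreover have "ncomp G (\<gamma> \<union> T) \<noteq> ncomp G T"
      using Un joined_eq_if_ncomp_eq[OF wf, of T "\<gamma> \<union> T"] sub(1)[OF TF] assms(3) by auto
    \<comment> \<open>Adding \<gamma> lowers the component number 2 strictly. Failing to be leading
      then means that \<open>T \<inter> \<gamma>\<close> does not have exactly one extra component;
      it does not have none either, so it has at least two.\<close>
    then have "ncomp G (\<gamma> \<union> T) = 1"
      using le(2,3) sub(2)[OF TF] conn by (simp add: ncomp_edges)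
    then have "ncomp G (T \<inter> \<gamma>) \<noteq> Suc (ncomp G \<gamma>)" using T(1) by simp
    ultimately show "Suc (Suc (loop_number (subgraph G \<gamma>))) \<le> card (\<gamma> \<inter> (edges G - T))"
      using card_Int_complement_forest[OF wf assms(3) TF] le(1) by simp
  qed
  moreover have "\<Phi> G = forest_sum (momentum_weight G) (edges G) {T \<in> ?F. ?P T} +
      forest_sum (momentum_weight G) (edges G) {T \<in> ?F. \<not> ?P T}"
    using \<Phi>_forest_sum[OF assms(1)] conn
      forest_sum_split[OF finite_spanning_trees[OF fin(2)], of _ _ 2 ?P] by (simp add: numeral_2_eq_2)
  ultimately show ?thesis using main by auto
qed

section \<open>Adding the mass terms\<close>

theorem theorem2p7:
  fixes G :: "('v, 'e, 'x, 'd :: finite) fgraph" and \<gamma> :: "'e set"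
  assumes "feynman_graph G" and "connected_graph G" and "\<gamma> \<subseteq> edges G"
  shows "(\<exists>R. \<Xi> G = \<Psi> (subgraph G \<gamma>) * \<Xi> (quotient_graph G \<gamma>) + R \<and>
              degree_greater \<gamma> (loop_number (subgraph G \<gamma>)) R) \<and>
         (mass_momentum_spanning G \<gamma> \<longrightarrow>
           (\<exists>R. \<Xi> G = \<Xi> (subgraph G \<gamma>) * \<Psi> (quotient_graph G \<gamma>) + R \<and>
                degree_greater \<gamma> (loop_number (subgraph G \<gamma>) + 1) R))"
proof (intro conjI impI)
  note wf = feynman_graph_well_formed[OF assms(1)]
  note Q = feynman_graph_quotient_graph[OF assms]
  let ?\<gamma> = "subgraph G \<gamma>" and ?Q = "quotient_graph G \<gamma>"
  let ?h = "loop_number ?\<gamma>"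
  define M where "M = (\<lambda>X. \<Sum>e\<in>X. const ((mass G e)\<^sup>2) * \<alpha> e)"
  have fin: "finite \<gamma>" "finite (edges G)"
    using wf assms(3) finite_subset by (auto simp: well_formed_def)
  have conn: "card (components G) = 1" using assms(2) by (simp add: connected_graph_def)
  obtain R\<^sub>1 where R\<^sub>1: "\<Psi> G = \<Psi> ?\<gamma> * \<Psi> ?Q + R\<^sub>1" "degree_at_least \<gamma> (Suc ?h) R\<^sub>1"
    using forest_sum_UV[OF wf assms(3), of "\<lambda>_. 1" "\<lambda>_. 1" 1] \<Psi>_forest_sum[OF wf] conn
      \<Psi>_forest_sum[OF well_formed_quotient_graph[OF wf], of \<gamma>] Q(1) by auto
  obtain R\<^sub>2 where R\<^sub>2: "\<Phi> G = \<Psi> ?\<gamma> * \<Phi> ?Q + R\<^sub>2" "degree_at_least \<gamma> (Suc ?h) R\<^sub>2"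
    using forest_sum_UV[OF wf assms(3), of "momentum_weight G" "momentum_weight ?Q" 2]
      momentum_weight_quotient_graph[OF wf assms(3)]
      \<Phi>_forest_sum[OF assms(1)] conn \<Phi>_forest_sum[OF Q(2)] Q(1) by (auto simp: numeral_2_eq_2)
  have M: "M (edges G) = M (edges G - \<gamma>) + M \<gamma>"
    unfolding M_def using sum.subset_diff[OF assms(3) fin(2)] .
  have M_deg: "degree_at_least \<gamma> 1 (M \<gamma>)"
    unfolding M_def
  proof (rule degree_at_least_sum)
    fix e assume "e \<in> \<gamma>"
    then show "degree_at_least \<gamma> 1 (const ((mass G e)\<^sup>2) * \<alpha> e)"
      using degree_at_least_mult[OF degree_at_least_0 degree_at_least_\<alpha>[OF fin(1)]] by simp
  qed
  \<comment> \<open>Multiplied by the mass terms of \<gamma>, this bound already gives degree at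
    least \<open>?h + 1\<close>, so that product can go into the ultraviolet remainder as a
    whole.\<close>
  have \<Psi>_deg: "degree_at_least \<gamma> ?h (\<Psi> G)"
  proof -
    have "ncomp G \<gamma> \<le> ncomp G (T \<inter> \<gamma>)" for T
      using wf by (intro ncomp_antimono(1)) (simp_all add: well_formed_def)
    then have "?h \<le> card (\<gamma> \<inter> (edges G - T))" if "T \<in> spanning_trees 1 G" for T
      using card_Int_complement_forest[OF wf assms(3) that] by (metis add_le_cancel_right add_le_mono le_refl)
    then show ?thesis
      unfolding \<Psi>_forest_sum[OF wf] conn using fin by (intro degree_at_least_forest_sum) auto
  qed
  have \<Xi>: "\<Xi> G = \<Phi> G + M (edges G) * \<Psi> G" by (simp add: \<Xi>_def M_def)
  show "\<exists>R. \<Xi> G = \<Psi> ?\<gamma> * \<Xi> ?Q + R \<and> degree_greater \<gamma> ?h R"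
  proof (intro exI conjI)
    have "\<Xi> ?Q = \<Phi> ?Q + M (edges G - \<gamma>) * \<Psi> ?Q" by (simp add: \<Xi>_def M_def)
    then show "\<Xi> G = \<Psi> ?\<gamma> * \<Xi> ?Q + (R\<^sub>2 + M (edges G - \<gamma>) * R\<^sub>1 + M \<gamma> * \<Psi> G)"
      unfolding \<Xi> M R\<^sub>2(1) by (simp add: R\<^sub>1(1) algebra_simps)
    show "degree_greater \<gamma> ?h (R\<^sub>2 + M (edges G - \<gamma>) * R\<^sub>1 + M \<gamma> * \<Psi> G)"
      using degree_at_least_mult[OF degree_at_least_0 R\<^sub>1(2)] degree_at_least_mult[OF M_deg \<Psi>_deg]
        R\<^sub>2(2)
      unfolding degree_greater_Suc by (intro degree_at_least_add) simp_all
  qed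
  assume mm: "mass_momentum_spanning G \<gamma>"
  obtain R\<^sub>3 where R\<^sub>3: "\<Phi> G = \<Phi> ?\<gamma> * \<Psi> ?Q + R\<^sub>3" "degree_at_least \<gamma> (Suc (Suc ?h)) R\<^sub>3"
    using forest_sum_IR[OF assms mm] by blast
  show "\<exists>R. \<Xi> G = \<Xi> ?\<gamma> * \<Psi> ?Q + R \<and> degree_greater \<gamma> (?h + 1) R"
  proof (intro exI conjI)
    \<comment> \<open>All massive edges lie in \<gamma>.\<close>
    have "M (edges G - \<gamma>) = 0"
      unfolding M_def using mm
      by (intro sum.neutral) (auto simp: mass_momentum_spanning_def mass_spanning_def)
    moreover have "\<Xi> ?\<gamma> = \<Phi> ?\<gamma> + M \<gamma> * \<Psi> ?\<gamma>"
      by (simp add: \<Xi>_def M_def mass_momentum_spanning_subgraph[OF mm])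
    \<comment> \<open>In contrast to the ultraviolet case, the product of \<open>M \<gamma>\<close>
      with the leading part of \<Psi> belongs to the main term. Only
      \<open>M \<gamma> * R\<^sub>1\<close> remains, of degree at least
      \<open>1 + (?h + 1)\<close>.\<close>
    ultimately show "\<Xi> G = \<Xi> ?\<gamma> * \<Psi> ?Q + (R\<^sub>3 + M \<gamma> * R\<^sub>1)"
      unfolding \<Xi> M R\<^sub>3(1) by (simp add: R\<^sub>1(1) algebra_simps)
    show "degree_greater \<gamma> (?h + 1) (R\<^sub>3 + M \<gamma> * R\<^sub>1)"
      using degree_at_least_mult[OF M_deg R\<^sub>1(2)] R\<^sub>3(2)
      unfolding degree_greater_Suc by (intro degree_at_least_add) simp_all
  qed
qed

end
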